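(* Let $\alpha\in(0,2)$, $\beta\in(-1,1)$, $x_0\in\mathbb{R}$, and let $f,g,\sigma:\mathbb{R}\to\mathbb{R}$ satisfy: (H1) there is $\gamma>0$ such that for all $x_1,x_2\in\mathbb{R}$, $|f(x_1)-f(x_2)|^2+|g(x_1)-g(x_2)|^2+\int_{|y|<1}|\sigma(x_1)y-\sigma(x_2)y|^2\,\nu^\alpha(dy)\le\gamma|x_1-x_2|^2$; (H2) there is $K>0$ such that for all $x\in\mathbb{R}$, $2xf(x)+|g(x)|^2+\int_{|y|<1}|\sigma(x)y|^2\,\nu^\alpha(dy)\le K(1+x^2)$; (H3) $|\sigma(\cdot)|^\alpha\in C^1(\mathbb{R})$ and $\sigma(x)\ne0$ for all $x\in\mathbb{R}$; (H4) $\sigma$ is strictly monotone. Consider the It\^o SDE driven by a one-dimensional asymmetric $\alpha$-stable L\'evy process $$dX_t=f(X_t)\,dt+g(X_t)\,dB_t+\sigma(X_{t-})\,dL^{\alpha,\beta}_t,\qquad X_0=x_0 .$$ Then the Fokker-Planck equation for this SDE is $$p_t=B^*p,\qquad p(x,0)=\delta(x-x_0),$$ where $$B^*p(x,t)=-\partial_x(f(x)p(x,t))+\tfrac12\partial_{xx}(g^2(x)p(x,t))+\widetilde Q^*p(x,t),$$ $$\widetilde Q^*v(x)=\int_{\mathbb{R}\setminus\{0\}}\Big[|\sigma(x+z)|^\alpha v(x+z)-|\sigma(x)|^\alpha v(x)-\big[|\sigma(x)|^\alpha v(x)\big]'z\,I_{\{|z|<|\sigma(x)|\}}(z)\Big]\tilde\nu_{\alpha,\beta}(dz)+\beta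 C_\alpha v(x)\sigma'(x),$$ with $$\tilde\nu_{\alpha,\beta}(dz)=\begin{cases}\nu_{\alpha,-\beta}(dz),&\text{if }\sigma\text{ is positive and strictly increasing},\\ \nu_{\alpha,\beta}(dz),&\text{if }\sigma\text{ is negative and strictly decreasing}.\end{cases}$$
   Context: The driving noise $B_t$ is a standard one-dimensional Brownian motion, independent of $L^{\alpha,\beta}$ (not to be confused with the operator $B^*$). $\nu^\alpha(du)=c(1,\alpha)|u|^{-1-\alpha}du$ with $c(1,\alpha)=\dfrac{\alpha\Gamma((1+\alpha)/2)}{2^{1-\alpha}\pi^{1/2}\Gamma(1-\alpha/2)}$ (used only in H1, H2). $L^{\alpha,\beta}$ is a one-dimensional asymmetric $\alpha$-stable L\'evy process with L\'evy measure $$\nu_{\alpha,\beta}(dy)=\frac{C_p(\beta)1_{\{y>0\}}+C_n(\beta)1_{\{y<0\}}}{|y|^{1+\alpha}}dy,\quad C_p(\beta)=C_\alpha\tfrac{1+\beta}{2},\ C_n(\beta)=C_\alpha\tfrac{1-\beta}{2},$$ where $C_\alpha=\dfrac{\alpha(1-\alpha)}{\Gamma(2-\alpha)\cos(\pi\alpha/2)}$ if $\alpha\ne1$ and $C_\alpha=2/\pi$ if $\alpha=1$. The generator of the SDE is $\mathcal{B}\varphi(x)=f(x)\varphi'(x)+\frac12g^2(x)\varphi''(x)+\int_{\mathbb{R}\setminus\{0\}}[\varphi(x+\sigma(x)y)-\varphi(x)-\sigma(x)y\varphi'(x)I_{\{|y|<1\}}(y)]\,\nu_{\alpha,\beta}(dy)$.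 The Fokker-Planck equation for the SDE is the evolution equation $\partial_tp=B^*p$ for the probability density $p(x,t)$ of $X_t$, where $B^*$ is the adjoint of $\mathcal{B}$ in the Hilbert space $L^2(\mathbb{R})$.
   Formalization: Only σ positive and strictly increasing, or negative and strictly decreasing, is covered, as ν̃ is undefined for other strictly monotone σ; B* is the adjoint of the generator on C_c², identified with the formula at v whose terms in it are defined a.e. and locally integrable. *)

theory Defs
  imports "HOL-Probability.Probability"
begin

section \<open>Levy measures\<close>

definition c1 :: "real \<Rightarrow> real" where
  "c1 \<alpha> = \<alpha> * Gamma ((1 + \<alpha>) / 2) / (2 powr (1 - \<alpha>) * sqrt pi * Gamma (1 - \<alpha> / 2))"

text \<open>In the densities below the value at the origin is \<open>0\<close>, since \<open>0 powr a = 0\<close> and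
  \<open>a / 0 = 0\<close>; the measures therefore live on the punctured line.\<close>

definition nu_sym :: "real \<Rightarrow> real measure" where
  "nu_sym \<alpha> = density lborel (\<lambda>u. ennreal (c1 \<alpha> / \<bar>u\<bar> powr (1 + \<alpha>)))"

definition C_stable :: "real \<Rightarrow> real" where
  "C_stable \<alpha> = (if \<alpha> = 1 then 2 / pi
     else \<alpha> * (1 - \<alpha>) / (Gamma (2 - \<alpha>) * cos (pi * \<alpha> / 2)))"

definition C_pos :: "real \<Rightarrow> real \<Rightarrow> real" where
  "C_pos \<alpha> \<beta> = C_stable \<alpha> * (1 + \<beta>) / 2"

definition C_neg :: "real \<Rightarrow> real \<Rightarrow> real" where
  "C_neg \<alpha> \<beta> = C_stable \<alpha> * (1 - \<beta>) / 2"

definition nu :: "real \<Rightarrow> real \<Rightarrow> real measure" where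
  "nu \<alpha> \<beta> = density lborel (\<lambda>y. ennreal
     ((C_pos \<alpha> \<beta> * indicator {0<..} y + C_neg \<alpha> \<beta> * indicator {..<0} y) / \<bar>y\<bar> powr (1 + \<alpha>)))"

text \<open>Only meaningful in the two cases \<open>\<sigma>\<close> positive and strictly increasing, or \<open>\<sigma>\<close> negative and
  strictly decreasing; it is only used there.\<close>

definition nu_tilde :: "real \<Rightarrow> real \<Rightarrow> (real \<Rightarrow> real) \<Rightarrow> real measure" where
  "nu_tilde \<alpha> \<beta> \<sigma> =
     (if (\<forall>x. 0 < \<sigma> x) \<and> strict_mono \<sigma> then nu \<alpha> (- \<beta>) else nu \<alpha> \<beta>)"


section \<open>Generator and adjoint\<close>

definition generator ::
  "real \<Rightarrow> real \<Rightarrow> (real \<Rightarrow> real) \<Rightarrow> (real \<Rightarrow> real) \<Rightarrow> (real \<Rightarrow> real)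
     \<Rightarrow> (real \<Rightarrow> real) \<Rightarrow> real \<Rightarrow> real" where
  "generator \<alpha> \<beta> f g \<sigma> \<phi> x =
     f x * deriv \<phi> x + 1/2 * (g x)\<^sup>2 * deriv (deriv \<phi>) x
     + (LINT y:-{0}|nu \<alpha> \<beta>.
          \<phi> (x + \<sigma> x * y) - \<phi> x - \<sigma> x * y * deriv \<phi> x * indicator {y. \<bar>y\<bar> < 1} y)"

definition C2c :: "(real \<Rightarrow> real) set" where
  "C2c = {\<phi>. (\<forall>x. \<phi> differentiable (at x)) \<and> (\<forall>x. deriv \<phi> differentiable (at x))
           \<and> continuous_on UNIV (deriv (deriv \<phi>)) \<and> (\<exists>R. \<forall>x. R < \<bar>x\<bar> \<longrightarrow> \<phi> x = 0)}"

definition L2 :: "(real \<Rightarrow> real) set" where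
  "L2 = {u. u \<in> borel_measurable lebesgue \<and> integrable lebesgue (\<lambda>x. (u x)\<^sup>2)}"

text \<open>\<open>is_adjoint A D v w\<close>: for \<open>A : D \<rightarrow> L2\<close>, the function \<open>v\<close> is in the domain of the Hilbert space
  adjoint of \<open>A\<close>, and the adjoint maps \<open>v\<close> to \<open>w\<close> (functions represent their almost-everywhere
  classes, so this is the graph of the adjoint).\<close>

definition is_adjoint ::
  "((real \<Rightarrow> real) \<Rightarrow> real \<Rightarrow> real) \<Rightarrow> (real \<Rightarrow> real) set
     \<Rightarrow> (real \<Rightarrow> real) \<Rightarrow> (real \<Rightarrow> real) \<Rightarrow> bool" where
  "is_adjoint A D v w \<longleftrightarrow> v \<in> L2 \<and> w \<in> L2 \<and>
     (\<forall>\<phi>\<in>D. (LINT x|lebesgue. A \<phi> x * v x) = (LINT x|lebesgue. \<phi> x * w x))"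

text \<open>The evolution equation \<open>\<partial>\<^sub>t p = B\<^sup>* p\<close>, with \<open>B\<^sup>*\<close> the adjoint of the generator and
  \<open>p t\<close> the function \<open>x \<mapsto> p(x,t)\<close>.\<close>

definition fokker_planck ::
  "real \<Rightarrow> real \<Rightarrow> (real \<Rightarrow> real) \<Rightarrow> (real \<Rightarrow> real) \<Rightarrow> (real \<Rightarrow> real)
     \<Rightarrow> (real \<Rightarrow> real \<Rightarrow> real) \<Rightarrow> bool" where
  "fokker_planck \<alpha> \<beta> f g \<sigma> p \<longleftrightarrow>
     (\<forall>t>0. \<exists>w. is_adjoint (generator \<alpha> \<beta> f g \<sigma>) C2c (p t) w
        \<and> (AE x in lebesgue. ((\<lambda>s. p s x) has_real_derivative w x) (at t)))"


section \<open>The explicit operator\<close>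

definition Q_integrand ::
  "real \<Rightarrow> (real \<Rightarrow> real) \<Rightarrow> (real \<Rightarrow> real) \<Rightarrow> real \<Rightarrow> real \<Rightarrow> real" where
  "Q_integrand \<alpha> \<sigma> v x z =
     \<bar>\<sigma> (x + z)\<bar> powr \<alpha> * v (x + z) - \<bar>\<sigma> x\<bar> powr \<alpha> * v x
     - deriv (\<lambda>y. \<bar>\<sigma> y\<bar> powr \<alpha> * v y) x * z * indicator {z. \<bar>z\<bar> < \<bar>\<sigma> x\<bar>} z"

definition Q_star :: "real \<Rightarrow> real \<Rightarrow> (real \<Rightarrow> real) \<Rightarrow> (real \<Rightarrow> real) \<Rightarrow> real \<Rightarrow> real" where
  "Q_star \<alpha> \<beta> \<sigma> v x =
     (LINT z:-{0}|nu_tilde \<alpha> \<beta> \<sigma>. Q_integrand \<alpha> \<sigma> v x z) + \<beta> * C_stable \<alpha> * v x * deriv \<sigma> x"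

definition B_star ::
  "real \<Rightarrow> real \<Rightarrow> (real \<Rightarrow> real) \<Rightarrow> (real \<Rightarrow> real) \<Rightarrow> (real \<Rightarrow> real)
     \<Rightarrow> (real \<Rightarrow> real) \<Rightarrow> real \<Rightarrow> real" where
  "B_star \<alpha> \<beta> f g \<sigma> v x =
     - deriv (\<lambda>y. f y * v y) x + 1/2 * deriv (deriv (\<lambda>y. (g y)\<^sup>2 * v y)) x + Q_star \<alpha> \<beta> \<sigma> v x"

text \<open>Local absolute continuity, in its fundamental-theorem-of-calculus form.\<close>

definition locally_ac :: "(real \<Rightarrow> real) \<Rightarrow> bool" where
  "locally_ac u \<longleftrightarrow> (AE x in lebesgue. u differentiable (at x)) \<and>
     (\<forall>a b. a \<le> b \<longrightarrow> deriv u absolutely_integrable_on {a..b}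
                    \<and> (deriv u has_integral (u b - u a)) {a..b})"

text \<open>The functions for which every term of \<open>B_star\<close> is defined almost everywhere and locally
  integrable. As \<open>f\<close> and \<open>g\<close> are merely Lipschitz, everywhere-defined derivatives of \<open>f v\<close> and
  second derivatives of \<open>g\<^sup>2 v\<close> would be too much to ask for. The condition on the nonlocal term
  holds for instance if \<open>|\<sigma>|\<^sup>\<alpha> v\<close> is twice continuously differentiable.\<close>

definition fp_regular ::
  "real \<Rightarrow> real \<Rightarrow> (real \<Rightarrow> real) \<Rightarrow> (real \<Rightarrow> real) \<Rightarrow> (real \<Rightarrow> real)
     \<Rightarrow> (real \<Rightarrow> real) \<Rightarrow> bool" where
  "fp_regular \<alpha> \<beta> f g \<sigma> v \<longleftrightarrow> v \<in> L2
     \<and> locally_ac (\<lambda>x. f x * v x)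
     \<and> locally_ac (\<lambda>x. (g x)\<^sup>2 * v x) \<and> locally_ac (deriv (\<lambda>x. (g x)\<^sup>2 * v x))
     \<and> locally_ac (\<lambda>x. \<bar>\<sigma> x\<bar> powr \<alpha> * v x)
     \<and> (\<forall>a b. set_integrable (lborel \<Otimes>\<^sub>M nu_tilde \<alpha> \<beta> \<sigma>) ({a..b} \<times> (-{0}))
               (\<lambda>(x, z). Q_integrand \<alpha> \<sigma> v x z))"

definition explicit_fokker_planck ::
  "real \<Rightarrow> real \<Rightarrow> (real \<Rightarrow> real) \<Rightarrow> (real \<Rightarrow> real) \<Rightarrow> (real \<Rightarrow> real)
     \<Rightarrow> (real \<Rightarrow> real \<Rightarrow> real) \<Rightarrow> bool" where
  "explicit_fokker_planck \<alpha> \<beta> f g \<sigma> p \<longleftrightarrow>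
     (\<forall>t>0. B_star \<alpha> \<beta> f g \<sigma> (p t) \<in> L2
        \<and> (AE x in lebesgue.
             ((\<lambda>s. p s x) has_real_derivative B_star \<alpha> \<beta> f g \<sigma> (p t) x) (at t)))"

text \<open>\<open>p(x,0) = \<delta>(x - x\<^sub>0)\<close>, as weak convergence of \<open>p(x,t) dx\<close> for \<open>t \<down> 0\<close>.\<close>

definition dirac_initial :: "(real \<Rightarrow> real \<Rightarrow> real) \<Rightarrow> real \<Rightarrow> bool" where
  "dirac_initial p x0 \<longleftrightarrow>
     (\<forall>h. continuous_on UNIV h \<and> bounded (range h) \<longrightarrow>
        ((\<lambda>t. LINT x|lborel. h x * p t x) \<longlongrightarrow> h x0) (at_right 0))"


section \<open>The stochastic differential equation\<close>

definition cadlag :: "(real \<Rightarrow> real) \<Rightarrow> bool" where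
  "cadlag x \<longleftrightarrow> (\<forall>t\<ge>0. continuous (at_right t) x) \<and> (\<forall>t>0. \<exists>l. (x \<longlongrightarrow> l) (at_left t))"

definition adapted :: "(real \<Rightarrow> 'w measure) \<Rightarrow> (real \<Rightarrow> 'w \<Rightarrow> real) \<Rightarrow> bool" where
  "adapted F Z \<longleftrightarrow> (\<forall>t\<ge>0. Z t \<in> borel_measurable (F t))"

definition indep_increments ::
  "'w measure \<Rightarrow> (real \<Rightarrow> 'w measure) \<Rightarrow> (real \<Rightarrow> 'w \<Rightarrow> real) \<Rightarrow> bool" where
  "indep_increments M F Z \<longleftrightarrow> (\<forall>s t. 0 \<le> s \<and> s \<le> t \<longrightarrow>
     prob_space.indep_set M (sets (F s))
       (sets (vimage_algebra (space M) (\<lambda>\<omega>. Z t \<omega> - Z s \<omega>) borel)))"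

definition brownian_motion ::
  "'w measure \<Rightarrow> (real \<Rightarrow> 'w measure) \<Rightarrow> (real \<Rightarrow> 'w \<Rightarrow> real) \<Rightarrow> bool" where
  "brownian_motion M F B \<longleftrightarrow> adapted F B \<and> indep_increments M F B
     \<and> (AE \<omega> in M. B 0 \<omega> = 0) \<and> (AE \<omega> in M. continuous_on {0..} (\<lambda>t. B t \<omega>))
     \<and> (\<forall>s t. 0 \<le> s \<and> s < t \<longrightarrow>
          distributed M lborel (\<lambda>\<omega>. B t \<omega> - B s \<omega>) (normal_density 0 (sqrt (t - s))))"

text \<open>The Levy process with triplet \<open>(0, 0, nu \<alpha> \<beta>)\<close> for the truncation \<open>|y| < 1\<close>, which is the one
  that matches the compensation in \<open>generator\<close>; its law is given by the Levy-Khintchine formula.\<close>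

definition stable_levy_process ::
  "'w measure \<Rightarrow> (real \<Rightarrow> 'w measure) \<Rightarrow> real \<Rightarrow> real \<Rightarrow> (real \<Rightarrow> 'w \<Rightarrow> real) \<Rightarrow> bool" where
  "stable_levy_process M F \<alpha> \<beta> L \<longleftrightarrow> adapted F L \<and> indep_increments M F L
     \<and> (AE \<omega> in M. L 0 \<omega> = 0) \<and> (AE \<omega> in M. cadlag (\<lambda>t. L t \<omega>))
     \<and> (\<forall>s t u. 0 \<le> s \<and> s \<le> t \<longrightarrow>
          char (distr M borel (\<lambda>\<omega>. L t \<omega> - L s \<omega>)) u =
          exp (complex_of_real (t - s) *
               (LINT y:-{0}|nu \<alpha> \<beta>.
                  iexp (u * y) - 1 - \<i> * complex_of_real (u * y * indicator {y. \<bar>y\<bar> < 1} y))))"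

definition indep_processes ::
  "'w measure \<Rightarrow> (real \<Rightarrow> 'w \<Rightarrow> real) \<Rightarrow> (real \<Rightarrow> 'w \<Rightarrow> real) \<Rightarrow> bool" where
  "indep_processes M Y Z \<longleftrightarrow>
     prob_space.indep_var M
       (PiM {0..} (\<lambda>_. borel)) (\<lambda>\<omega>. \<lambda>t\<in>{0..}. Y t \<omega>)
       (PiM {0..} (\<lambda>_. borel)) (\<lambda>\<omega>. \<lambda>t\<in>{0..}. Z t \<omega>)"

text \<open>\<open>ito_integral M H Z t I\<close>: \<open>I\<close> is the Ito integral over \<open>(0,t]\<close> of the left limits of \<open>H\<close> against
  \<open>Z\<close>, for \<open>H\<close> adapted and cadlag and \<open>Z\<close> a semimartingale, i.e. the limit in probability of the
  left-endpoint Riemann sums along partitions \<open>0 = \<tau> n 0 \<le> \<dots> \<le> \<tau> n (k n) = t\<close> of vanishing mesh.\<close>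

definition ito_integral ::
  "'w measure \<Rightarrow> (real \<Rightarrow> 'w \<Rightarrow> real) \<Rightarrow> (real \<Rightarrow> 'w \<Rightarrow> real) \<Rightarrow> real \<Rightarrow> ('w \<Rightarrow> real) \<Rightarrow> bool" where
  "ito_integral M H Z t I \<longleftrightarrow> I \<in> borel_measurable M \<and>
     (\<forall>\<tau> :: nat \<Rightarrow> nat \<Rightarrow> real. \<forall>k :: nat \<Rightarrow> nat.
        (\<forall>n. \<tau> n 0 = 0 \<and> \<tau> n (k n) = t \<and> (\<forall>i<k n. \<tau> n i \<le> \<tau> n (Suc i))) \<and>
        (\<forall>\<epsilon>>0. \<forall>\<^sub>F n in sequentially. \<forall>i<k n. \<tau> n (Suc i) - \<tau> n i < \<epsilon>)
        \<longrightarrow> (\<forall>\<epsilon>>0. (\<lambda>n. measure M {\<omega> \<in> space M.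
               \<epsilon> < \<bar>(\<Sum>i<k n. H (\<tau> n i) \<omega> * (Z (\<tau> n (Suc i)) \<omega> - Z (\<tau> n i) \<omega>)) - I \<omega>\<bar>})
               \<longlonglongrightarrow> 0))"

definition sde_solution ::
  "'w measure \<Rightarrow> (real \<Rightarrow> 'w measure) \<Rightarrow> (real \<Rightarrow> 'w \<Rightarrow> real) \<Rightarrow> (real \<Rightarrow> 'w \<Rightarrow> real)
     \<Rightarrow> real \<Rightarrow> real \<Rightarrow> (real \<Rightarrow> real) \<Rightarrow> (real \<Rightarrow> real) \<Rightarrow> (real \<Rightarrow> real)
     \<Rightarrow> real \<Rightarrow> (real \<Rightarrow> 'w \<Rightarrow> real) \<Rightarrow> bool" where
  "sde_solution M F B L \<alpha> \<beta> f g \<sigma> x0 X \<longleftrightarrow>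
     prob_space M \<and> filtration (space M) F \<and> (\<forall>t. subalgebra M (F t))
     \<and> brownian_motion M F B \<and> stable_levy_process M F \<alpha> \<beta> L \<and> indep_processes M B L
     \<and> adapted F X \<and> (AE \<omega> in M. cadlag (\<lambda>t. X t \<omega>)) \<and> (AE \<omega> in M. X 0 \<omega> = x0)
     \<and> (\<exists>I J. \<forall>t\<ge>0. ito_integral M (\<lambda>s \<omega>. g (X s \<omega>)) B t (I t)
            \<and> ito_integral M (\<lambda>s \<omega>. \<sigma> (X s \<omega>)) L t (J t)
            \<and> (AE \<omega> in M. X t \<omega> = x0 + (LINT s:{0..t}|lborel. f (X s \<omega>)) + I t \<omega> + J t \<omega>))"

definition has_densities ::
  "'w measure \<Rightarrow> (real \<Rightarrow> 'w \<Rightarrow> real) \<Rightarrow> (real \<Rightarrow> real \<Rightarrow> real) \<Rightarrow> bool" where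
  "has_densities M X p \<longleftrightarrow>
     (\<forall>t>0. (\<forall>x. 0 \<le> p t x) \<and> distributed M lborel (X t) (\<lambda>x. ennreal (p t x)))"

end

theory Submission
  imports Defs
begin

text \<open>
  After the substitution \<open>z = \<sigma>(x) y\<close> both signs of \<open>\<sigma>\<close> reduce to one case: with \<open>s = |\<sigma>|\<close>, which is
  positive and strictly increasing, and \<open>b = sgn \<sigma> \<cdot> \<beta>\<close>, the jump part of the generator is \<open>s\<^sup>\<alpha>\<close> times the
  integral of \<open>\<phi>(x + z) - \<phi>(x) - z \<phi>'(x) 1\<^bsub>|z| < s(x)\<^esub>\<close> against \<open>\<nu>\<^bsub>\<alpha>,b\<^esub>\<close>. Since \<open>s\<close> grows at most linearly it
  is \<open>O(1 / (1 + |x|))\<close>, hence square integrable, and it can be paired with \<open>v\<close> by Fubini's theorem.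
  Exchanging the integrals, one compares the two sides for each fixed jump size \<open>z\<close> by translation and
  integration by parts; the truncation at \<open>s(x)\<close> leaves the boundary term that becomes
  \<open>\<beta> C\<^sub>\<alpha> v \<sigma>'\<close>. The fundamental lemma of the calculus of variations then identifies the adjoint.
\<close>

text \<open>The substitution turns the truncation \<open>|y| < 1\<close> into
  \<open>|z| < s x\<close>, a threshold that moves with \<open>x\<close>. Under a constant threshold
  the integration by parts for a fixed jump size would run over the whole line or over nothing, and
  the adjoint would merely reverse the jumps; here it runs over a half line whose endpoint
  contributes. Positive and negative jumps contribute with opposite signs and with the weights
  \<open>C_pos\<close> and \<open>C_neg\<close>, whose difference is
  \<open>b * C_stable \<alpha>\<close>. The derivative of \<open>s\<close> carries the sign of
  \<sigma> as well, so the two signs cancel and leave \<beta> times the derivative of \<sigma>. The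
  obstacle is low regularity: the products of coefficients with \<open>v\<close> are only locally
  absolutely continuous, so their derivatives exist almost everywhere and integration by parts has
  to rest on Fubini's theorem. Product integrals over \<open>lborel\<close> in turn demand Borel
  measurable factors, while the hypotheses speak of \<open>lebesgue\<close>. The linear growth of
  \<open>s\<close> is hidden in (H1): the truncated second moment of the symmetric Levy measure is
  finite and positive, so \<sigma> is Lipschitz.\<close>

lemma C2cI:
  assumes "\<And>x. (\<phi> has_real_derivative \<phi>' x) (at x)"
    and "\<And>x. (\<phi>' has_real_derivative \<phi>'' x) (at x)"
    and "continuous_on UNIV \<phi>''" and "\<And>x. R < \<bar>x\<bar> \<Longrightarrow> \<phi> x = 0"
  shows "\<phi> \<in> C2c"
proof -
  have "deriv \<phi> = \<phi>'" "deriv \<phi>' = \<phi>''"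
    using assms by (auto intro!: DERIV_imp_deriv)
  with assms show ?thesis
    unfolding C2c_def by (auto simp: real_differentiable_def)
qed

lemma C2cE:
  assumes "\<phi> \<in> C2c"
  obtains R where "R > 0"
    and "\<And>x. (\<phi> has_real_derivative deriv \<phi> x) (at x)"
    and "\<And>x. (deriv \<phi> has_real_derivative deriv (deriv \<phi>) x) (at x)"
    and "continuous_on UNIV \<phi>" "continuous_on UNIV (deriv \<phi>)"
    and "continuous_on UNIV (deriv (deriv \<phi>))"
    and "\<And>x. R \<le> \<bar>x\<bar> \<Longrightarrow> \<phi> x = 0" "\<And>x. R \<le> \<bar>x\<bar> \<Longrightarrow> deriv \<phi> x = 0"
    and "\<And>x. R \<le> \<bar>x\<bar> \<Longrightarrow> deriv (deriv \<phi>) x = 0"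
proof -
  from assms obtain R0 where R0: "\<And>x. R0 < \<bar>x\<bar> \<Longrightarrow> \<phi> x = 0"
    and d1: "\<And>x. \<phi> differentiable (at x)" and d2: "\<And>x. deriv \<phi> differentiable (at x)"
    and c2: "continuous_on UNIV (deriv (deriv \<phi>))"
    unfolding C2c_def by auto
  have D1: "\<And>x. (\<phi> has_real_derivative deriv \<phi> x) (at x)"
    using d1 by (metis DERIV_deriv_iff_real_differentiable)
  have D2: "\<And>x. (deriv \<phi> has_real_derivative deriv (deriv \<phi>) x) (at x)"
    using d2 by (metis DERIV_deriv_iff_real_differentiable)
  have op: "open {x::real. R0 < \<bar>x\<bar>}"
    by (intro open_Collect_less continuous_intros)
  have z1: "deriv \<phi> x = 0" if "R0 < \<bar>x\<bar>" for x
  proof -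
    have "(\<phi> has_real_derivative 0) (at x)"
      by (rule has_field_derivative_transform_within_open[where f = "\<lambda>_. 0", OF _ op])
        (use that R0 in auto)
    then show ?thesis by (rule DERIV_imp_deriv)
  qed
  have z2: "deriv (deriv \<phi>) x = 0" if "R0 < \<bar>x\<bar>" for x
  proof -
    have "(deriv \<phi> has_real_derivative 0) (at x)"
      by (rule has_field_derivative_transform_within_open[where f = "\<lambda>_. 0", OF _ op])
        (use that z1 in auto)
    then show ?thesis by (rule DERIV_imp_deriv)
  qed
  \<comment> \<open>Enlarging the radius makes it positive and turns the strict inequality of
    \<open>C2c\<close> into a weak one.\<close>
  show thesis
  proof (rule that[of "max 1 (R0 + 1)"])
    show "continuous_on UNIV \<phi>" "continuous_on UNIV (deriv \<phi>)"
      using D1 D2 by (meson DERIV_isCont continuous_at_imp_continuous_on)+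
  qed (use R0 z1 z2 D1 D2 c2 in auto)
qed

section \<open>Compactly supported continuous functions and square-integrable functions\<close>

lemma continuous_compact_support_bounded:
  fixes h :: "real \<Rightarrow> real"
  assumes "continuous_on UNIV h" and "\<And>x. R \<le> \<bar>x\<bar> \<Longrightarrow> h x = 0"
  obtains C where "C \<ge> 0" "\<And>x. \<bar>h x\<bar> \<le> C"
proof -
  have "compact (h ` {-\<bar>R\<bar>..\<bar>R\<bar>})"
    by (intro compact_continuous_image continuous_on_subset[OF assms(1)]) auto
  then obtain C where C: "\<And>x. x \<in> {-\<bar>R\<bar>..\<bar>R\<bar>} \<Longrightarrow> \<bar>h x\<bar> \<le> C"
    using compact_imp_bounded by (force simp: bounded_iff)
  have "\<bar>h x\<bar> \<le> max C 0" for x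
  proof (cases "R \<le> \<bar>x\<bar>")
    case False
    then have "x \<in> {-\<bar>R\<bar>..\<bar>R\<bar>}" by auto
    from C[OF this] show ?thesis by simp
  qed (use assms(2) in simp)
  then show thesis using that[of "max C 0"] by auto
qed

lemma continuous_compact_support_integrable:
  fixes h :: "real \<Rightarrow> real"
  assumes "continuous_on UNIV h" and "\<And>x. R \<le> \<bar>x\<bar> \<Longrightarrow> h x = 0"
  shows "integrable lborel h"
proof -
  have "set_integrable lborel {-\<bar>R\<bar>..\<bar>R\<bar>} h"
    by (intro borel_integrable_atLeastAtMost' continuous_on_subset[OF assms(1)]) auto
  moreover have "(\<lambda>x. indicator {-\<bar>R\<bar>..\<bar>R\<bar>} x *\<^sub>R h x) = h"
  proof
    show "indicator {-\<bar>R\<bar>..\<bar>R\<bar>} x *\<^sub>R h x = h x" for x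
      using assms(2)[of x] by (cases "R \<le> \<bar>x\<bar>") (auto simp: indicator_def)
  qed
  ultimately show ?thesis by (simp add: set_integrable_def)
qed

lemma continuous_compact_support_L2:
  fixes h :: "real \<Rightarrow> real"
  assumes "continuous_on UNIV h" and "\<And>x. R \<le> \<bar>x\<bar> \<Longrightarrow> h x = 0"
  shows "h \<in> L2"
proof -
  have [measurable]: "h \<in> borel_measurable borel"
    using assms(1) by (simp add: borel_measurable_continuous_onI)
  have "integrable lborel (\<lambda>x. (h x)\<^sup>2)"
    by (rule continuous_compact_support_integrable[where R = R])
      (use assms in \<open>auto intro!: continuous_intros\<close>)
  then show ?thesis
    unfolding L2_def by (auto simp: integrable_completion measurable_completion)
qed

lemma L2_add:
  assumes "u \<in> L2" "v \<in> L2"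
  shows "(\<lambda>x. u x + v x) \<in> L2"
proof -
  have [measurable]: "u \<in> borel_measurable lebesgue" "v \<in> borel_measurable lebesgue"
    and i: "integrable lebesgue (\<lambda>x. (u x)\<^sup>2)" "integrable lebesgue (\<lambda>x. (v x)\<^sup>2)"
    using assms by (auto simp: L2_def)
  have "integrable lebesgue (\<lambda>x. (u x + v x)\<^sup>2)"
  proof (rule Bochner_Integration.integrable_bound)
    show "integrable lebesgue (\<lambda>x. 2 * ((u x)\<^sup>2 + (v x)\<^sup>2))" using i by auto
    have "(a + b)\<^sup>2 \<le> 2 * (a\<^sup>2 + b\<^sup>2)" for a b :: real
      using sum_squares_bound[of a b] by (simp add: power2_eq_square algebra_simps)
    then show "AE x in lebesgue. norm ((u x + v x)\<^sup>2) \<le> norm (2 * ((u x)\<^sup>2 + (v x)\<^sup>2))"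
      by auto
  qed auto
  then show ?thesis by (auto simp: L2_def)
qed

lemma L2_integrable_mult:
  assumes "u \<in> L2" "v \<in> L2"
  shows "integrable lebesgue (\<lambda>x. u x * v x)"
proof -
  have [measurable]: "u \<in> borel_measurable lebesgue" "v \<in> borel_measurable lebesgue"
    and i: "integrable lebesgue (\<lambda>x. (u x)\<^sup>2)" "integrable lebesgue (\<lambda>x. (v x)\<^sup>2)"
    using assms by (auto simp: L2_def)
  show ?thesis
  proof (rule Bochner_Integration.integrable_bound)
    show "integrable lebesgue (\<lambda>x. (u x)\<^sup>2 + (v x)\<^sup>2)" using i by auto
    have "\<bar>a * b\<bar> \<le> a\<^sup>2 + b\<^sup>2" for a b :: real
    proof -
      have "2 * \<bar>a * b\<bar> \<le> a\<^sup>2 + b\<^sup>2"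
        using sum_squares_bound[of "\<bar>a\<bar>" "\<bar>b\<bar>"] by (simp add: abs_mult)
      then show ?thesis using abs_ge_zero[of "a * b"] by linarith
    qed
    then show "AE x in lebesgue. norm (u x * v x) \<le> norm ((u x)\<^sup>2 + (v x)\<^sup>2)"
      by auto
  qed auto
qed

lemma L2_AE_cong:
  assumes "w \<in> L2" and "AE x in lebesgue. w x = w' x"
  shows "w' \<in> L2"
proof -
  have m: "w' \<in> borel_measurable lebesgue"
    by (rule borel_measurable_AE[of w]) (use assms in \<open>auto simp: L2_def\<close>)
  have [measurable]: "w \<in> borel_measurable lebesgue" using assms by (auto simp: L2_def)
  have "integrable lebesgue (\<lambda>x. (w' x)\<^sup>2) \<longleftrightarrow> integrable lebesgue (\<lambda>x. (w x)\<^sup>2)"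
    using m assms(2) by (intro integrable_cong_AE) (auto simp: borel_measurable_power)
  with m assms(1) show ?thesis by (auto simp: L2_def)
qed

section \<open>Integration by parts\<close>

text \<open>On each interval \<open>u\<close> is a constant plus the indefinite integral of
  \<open>deriv u\<close>. The pointwise derivative may be missing on a null set, so continuity has
  to come from this integral form.\<close>

lemma locally_ac_continuous:
  assumes "locally_ac u"
  shows "continuous_on UNIV u"
proof -
  have "isCont u x" for x
  proof -
    let ?I = "\<lambda>y. integral {x - 1..y} (deriv u)"
    have hi: "(deriv u has_integral (u b - u a)) {a..b}" if "a \<le> b" for a b
      using assms that by (auto simp: locally_ac_def)
    have "continuous_on {x-1..x+1} ?I"
      by (rule indefinite_integral_continuous_1) (use hi[of "x - 1" "x + 1"] in \<open>auto simp: integrable_on_def\<close>)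
    then have "continuous_on {x-1..x+1} (\<lambda>y. u (x - 1) + ?I y)"
      by (intro continuous_intros)
    then have "continuous_on {x-1..x+1} u"
      by (rule continuous_on_eq) (use integral_unique[OF hi] in auto)
    then show "isCont u x"
      by (rule continuous_on_interior) auto
  qed
  then show ?thesis by (simp add: continuous_on_eq_continuous_at)
qed

lemma integrable_pair_mult:
  fixes p w :: "real \<Rightarrow> real"
  assumes "integrable lborel p" "integrable lborel w"
  shows "integrable (lborel \<Otimes>\<^sub>M lborel) (\<lambda>(x, y). p x * w y)"
proof -
  have [measurable]: "p \<in> borel_measurable borel" "w \<in> borel_measurable borel"
    using borel_measurable_integrable[OF assms(1)] borel_measurable_integrable[OF assms(2)] by auto
  show ?thesis
  proof (rule lborel_pair.Fubini_integrable)
    show "integrable lborel (\<lambda>x. \<integral>y. norm (case (x, y) of (x, y) \<Rightarrow> p x * w y) \<partial>lborel)"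
      using assms by (auto simp: abs_mult)
  qed (use assms in auto)
qed

text \<open>The product rule is available only almost everywhere, which does not support the
  fundamental theorem. Instead \<open>u x - u a\<close> is written as the integral of
  \<open>deriv u\<close> over \<open>y \<le> x\<close>, and Fubini's theorem is applied to
  \<open>\<psi> x * deriv u y\<close> on the triangle
  \<open>a \<le> y \<le> x \<le> b\<close>.\<close>

lemma locally_ac_by_parts:
  assumes u: "locally_ac u" and ab: "a \<le> b"
    and D: "\<And>x. (\<phi> has_real_derivative \<psi> x) (at x)" and \<psi>: "continuous_on UNIV \<psi>"
  shows "set_integrable lebesgue {a..b} (\<lambda>x. \<phi> x * deriv u x)"
    and "(LINT x:{a..b}|lebesgue. \<phi> x * deriv u x)
         = \<phi> b * u b - \<phi> a * u a - (LINT x:{a..b}|lebesgue. \<psi> x * u x)"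
proof -
  have cu: "continuous_on UNIV u" by (rule locally_ac_continuous[OF u])
  have c\<phi>: "continuous_on UNIV \<phi>"
    using D DERIV_isCont by (auto simp: continuous_on_eq_continuous_at)
  have [measurable]: "u \<in> borel_measurable borel" "\<phi> \<in> borel_measurable borel"
      "\<psi> \<in> borel_measurable borel"
    using cu c\<phi> \<psi> by (auto intro: borel_measurable_continuous_onI)
  have du: "set_integrable lebesgue {a..b} (deriv u)"
    using u ab by (auto simp: locally_ac_def)
  have ui: "(deriv u has_integral (u x - u y)) {y..x}" if "y \<le> x" for x y
    using u that by (auto simp: locally_ac_def)
  \<comment> \<open>The derivative is Lebesgue measurable only; a Borel representative that vanishes
    outside \<open>{a..b}\<close> is needed on the product of two copies of
    \<open>lborel\<close>.\<close>
  obtain w0 where w0[measurable]: "w0 \<in> borel_measurable lborel"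
    and "AE x in lborel. indicator {a..b} x *\<^sub>R deriv u x = w0 x"
    using completion_ex_borel_measurable_real[of "\<lambda>x. indicator {a..b} x *\<^sub>R deriv u x"] du
    unfolding set_integrable_def by blast
  then have w0AE: "AE x in lebesgue. indicator {a..b} x *\<^sub>R deriv u x = w0 x"
    by (auto intro: AE_completion)
  define w where "w x = indicator {a..b} x * w0 x" for x
  have [measurable]: "w \<in> borel_measurable borel" unfolding w_def by auto
  have wAE: "AE x in lebesgue. indicator {a..b} x * deriv u x = w x"
    using w0AE
  proof eventually_elim
    case (elim x)
    then show ?case by (cases "x \<in> {a..b}") (auto simp: w_def)
  qed
  have wL: "w \<in> borel_measurable lebesgue" by (simp add: measurable_completion)
  have "integrable lebesgue w"
    using du unfolding set_integrable_def
    by (rule integrable_cong_AE_imp) (use wAE wL in auto)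
  then have wi: "integrable lborel w" by (simp add: integrable_completion)
  have wx: "(\<integral>y. w y * indicator {..x} y \<partial>lborel) = u x - u a" if "x \<in> {a..b}" for x
  proof -
    have "set_integrable lebesgue {a..x} (deriv u)"
      using u that by (auto simp: locally_ac_def)
    from has_integral_set_lebesgue[OF this] ui[of a x] that
    have "(LINT y:{a..x}|lebesgue. deriv u y) = u x - u a"
      by (auto intro: has_integral_unique)
    moreover have "(LINT y:{a..x}|lebesgue. deriv u y) = (\<integral>y. w y * indicator {..x} y \<partial>lebesgue)"
      unfolding set_lebesgue_integral_def
    proof (rule integral_cong_AE)
      show "(\<lambda>y. indicator {a..x} y *\<^sub>R deriv u y) \<in> borel_measurable lebesgue"
        using u that unfolding locally_ac_def set_integrable_def by auto
      show "(\<lambda>y. w y * indicator {..x} y) \<in> borel_measurable lebesgue"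
        by (intro measurable_completion) auto
      show "AE y in lebesgue. indicator {a..x} y *\<^sub>R deriv u y = w y * indicator {..x} y"
        using wAE by eventually_elim (use that in \<open>auto simp: indicator_def split: if_splits\<close>)
    qed
    ultimately show ?thesis by (simp add: integral_completion)
  qed
  let ?p = "\<lambda>x. indicator {a..b} x * \<psi> x"
  have ip: "integrable lborel ?p"
    using borel_integrable_atLeastAtMost'[OF continuous_on_subset[OF \<psi>], of a b]
    by (simp add: set_integrable_def)
  \<comment> \<open>Integrating first over \<open>y\<close> recovers \<open>u x - u a\<close>;
    integrating first over \<open>x\<close> recovers \<open>\<phi> b - \<phi> y\<close>.\<close>
  let ?G = "\<lambda>(x, y). ?p x * (w y * indicator {..x} y)"
  have iG: "integrable (lborel \<Otimes>\<^sub>M lborel) ?G"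
  proof (rule Bochner_Integration.integrable_bound[OF integrable_pair_mult[OF ip wi]])
    have [measurable]: "(\<lambda>(x::real, y::real). indicator {..x} y :: real) \<in> borel_measurable (borel \<Otimes>\<^sub>M borel)"
      unfolding indicator_def atMost_iff by measurable
    show "?G \<in> borel_measurable (lborel \<Otimes>\<^sub>M lborel)" by measurable
  qed (auto simp: indicator_def)
  have e1: "(\<integral>x. \<integral>y. ?G (x, y) \<partial>lborel \<partial>lborel) = (\<integral>x. ?p x * (u x - u a) \<partial>lborel)"
    using wx by (intro Bochner_Integration.integral_cong) (auto simp: indicator_def)
  have ftc: "(\<integral>x. ?p x * indicator {y..} x \<partial>lborel) = \<phi> b - \<phi> y" if "y \<in> {a..b}" for y
  proof -
    have "(\<integral>x. ?p x * indicator {y..} x \<partial>lborel) = (\<integral>x. \<psi> x * indicator {y..b} x \<partial>lborel)"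
      using that by (intro Bochner_Integration.integral_cong) (auto simp: indicator_def)
    also have "\<dots> = \<phi> b - \<phi> y"
      by (rule integral_FTC_Icc_real)
        (use that D \<psi> in \<open>auto simp: continuous_on_eq_continuous_at\<close>)
    finally show ?thesis .
  qed
  have iw: "integrable lborel (\<lambda>y. w y * \<phi> y)"
  proof -
    have "compact (\<phi> ` {a..b})"
      by (intro compact_continuous_image continuous_on_subset[OF c\<phi>]) auto
    then obtain C where C: "\<And>x. x \<in> {a..b} \<Longrightarrow> \<bar>\<phi> x\<bar> \<le> C"
      using compact_imp_bounded by (force simp: bounded_iff)
    show ?thesis
    proof (rule Bochner_Integration.integrable_bound)
      show "integrable lborel (\<lambda>y. C * w y)" using wi by auto
      have "norm (w y * \<phi> y) \<le> norm (C * w y)" for y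
      proof (cases "y \<in> {a..b}")
        case True
        with C[OF True] show ?thesis
          by (simp add: abs_mult mult.commute[of "\<bar>w y\<bar>"] mult_right_mono order_trans[OF _ abs_ge_self])
      qed (simp add: w_def)
      then show "AE y in lborel. norm (w y * \<phi> y) \<le> norm (C * w y)" by auto
    qed auto
  qed
  have "(\<integral>x. \<integral>y. ?G (x, y) \<partial>lborel \<partial>lborel) = (\<integral>y. \<integral>x. ?G (x, y) \<partial>lborel \<partial>lborel)"
    using lborel_pair.Fubini_integral[of "\<lambda>x y. ?G (x, y)"] iG by simp
  also have "\<dots> = (\<integral>y. w y * (\<phi> b - \<phi> y) \<partial>lborel)"
  proof (rule Bochner_Integration.integral_cong)
    fix y
    have "(\<integral>x. ?G (x, y) \<partial>lborel) = (\<integral>x. w y * (?p x * indicator {y..} x) \<partial>lborel)"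
      by (intro Bochner_Integration.integral_cong) (auto simp: indicator_def)
    also have "\<dots> = w y * (\<integral>x. ?p x * indicator {y..} x \<partial>lborel)" by simp
    also have "\<dots> = w y * (\<phi> b - \<phi> y)"
      using ftc[of y] by (cases "y \<in> {a..b}") (auto simp: w_def)
    finally show "(\<integral>x. ?G (x, y) \<partial>lborel) = w y * (\<phi> b - \<phi> y)" .
  qed simp
  also have "\<dots> = \<phi> b * (\<integral>y. w y \<partial>lborel) - (\<integral>y. w y * \<phi> y \<partial>lborel)"
    using wi iw by (simp add: algebra_simps)
  also have "(\<integral>y. w y \<partial>lborel) = u b - u a"
  proof -
    have "(\<integral>y. w y \<partial>lborel) = (\<integral>y. w y * indicator {..b} y \<partial>lborel)"
      by (intro Bochner_Integration.integral_cong) (auto simp: w_def indicator_def)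
    with wx[of b] ab show ?thesis by simp
  qed
  finally have key: "(\<integral>x. ?p x * (u x - u a) \<partial>lborel) =
      \<phi> b * (u b - u a) - (\<integral>y. w y * \<phi> y \<partial>lborel)" using e1 by simp
  have ipu: "integrable lborel (\<lambda>x. ?p x * u x)"
    using borel_integrable_atLeastAtMost'[of a b "\<lambda>x. \<psi> x * u x"]
      continuous_on_subset[OF continuous_on_mult[OF \<psi> cu], of "{a..b}"]
    by (simp add: set_integrable_def mult_ac)
  have "(\<integral>x. ?p x * (u x - u a) \<partial>lborel) = (\<integral>x. ?p x * u x \<partial>lborel) - (\<integral>x. ?p x \<partial>lborel) * u a"
    using ip ipu by (simp add: right_diff_distrib)
  also have "(\<integral>x. ?p x \<partial>lborel) = \<phi> b - \<phi> a"
  proof -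
    have "(\<integral>x. ?p x \<partial>lborel) = (\<integral>x. ?p x * indicator {a..} x \<partial>lborel)"
      by (intro Bochner_Integration.integral_cong) (auto simp: indicator_def)
    with ftc[of a] ab show ?thesis by simp
  qed
  finally have fin: "(\<integral>y. w y * \<phi> y \<partial>lborel) = \<phi> b * u b - \<phi> a * u a - (\<integral>x. ?p x * u x \<partial>lborel)"
    using key by (simp add: algebra_simps)
  have AE': "AE x in lebesgue. w x * \<phi> x = indicator {a..b} x *\<^sub>R (\<phi> x * deriv u x)"
    using wAE by eventually_elim (auto simp: indicator_def split: if_splits)
  have m1: "(\<lambda>x. w x * \<phi> x) \<in> borel_measurable lebesgue"
    by (intro measurable_completion) auto
  have m2: "(\<lambda>x. indicator {a..b} x *\<^sub>R (\<phi> x * deriv u x)) \<in> borel_measurable lebesgue"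
    by (rule borel_measurable_AE[OF m1 AE'])
  have "integrable lebesgue (\<lambda>x. w x * \<phi> x)" using iw by (simp add: integrable_completion)
  then show "set_integrable lebesgue {a..b} (\<lambda>x. \<phi> x * deriv u x)"
    unfolding set_integrable_def by (rule integrable_cong_AE_imp) (use AE' m2 in auto)
  have l1: "(LINT x:{a..b}|lebesgue. \<phi> x * deriv u x) = (\<integral>y. w y * \<phi> y \<partial>lebesgue)"
    unfolding set_lebesgue_integral_def
    by (rule integral_cong_AE) (use m1 m2 AE' in auto)
  have l2: "(\<integral>x. ?p x * u x \<partial>lborel) = (LINT x:{a..b}|lebesgue. \<psi> x * u x)"
    unfolding set_lebesgue_integral_def
    by (subst integral_completion) (auto simp: mult_ac)
  show "(LINT x:{a..b}|lebesgue. \<phi> x * deriv u x)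
         = \<phi> b * u b - \<phi> a * u a - (LINT x:{a..b}|lebesgue. \<psi> x * u x)"
    using fin l1 l2 by (simp add: integral_completion)
qed

lemma integral_compact_support:
  fixes h :: "real \<Rightarrow> real"
  assumes "\<And>x. R \<le> \<bar>x\<bar> \<Longrightarrow> h x = 0"
  shows "(LINT x:{-R..R}|M. h x) = (LINT x|M. h x)"
    and "set_integrable M {-R..R} h \<longleftrightarrow> integrable M h"
proof -
  have "(\<lambda>x. indicator {-R..R} x *\<^sub>R h x) = h"
  proof
    show "indicator {-R..R} x *\<^sub>R h x = h x" for x
      using assms[of x] by (cases "R \<le> \<bar>x\<bar>") (auto simp: indicator_def)
  qed
  then show "(LINT x:{-R..R}|M. h x) = (LINT x|M. h x)"
     "set_integrable M {-R..R} h \<longleftrightarrow> integrable M h"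
    unfolding set_lebesgue_integral_def set_integrable_def by simp_all
qed

lemma locally_ac_by_parts_compact_support:
  assumes u: "locally_ac u" and "R > 0"
    and D: "\<And>x. (\<phi> has_real_derivative \<psi> x) (at x)" and \<psi>: "continuous_on UNIV \<psi>"
    and z: "\<And>x. R \<le> \<bar>x\<bar> \<Longrightarrow> \<phi> x = 0" "\<And>x. R \<le> \<bar>x\<bar> \<Longrightarrow> \<psi> x = 0"
  shows "integrable lebesgue (\<lambda>x. \<phi> x * deriv u x)"
    and "(LINT x|lebesgue. \<phi> x * deriv u x) = - (LINT x|lebesgue. \<psi> x * u x)"
  using locally_ac_by_parts[OF u _ D \<psi>, of "-R" R] \<open>R > 0\<close> z
    integral_compact_support[where R = R and M = lebesgue and h = "\<lambda>x. \<phi> x * deriv u x"]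
    integral_compact_support[where R = R and M = lebesgue and h = "\<lambda>x. \<psi> x * u x"]
  by auto

section \<open>The fundamental lemma of the calculus of variations\<close>

text \<open>Powers of the positive part are glued from zero and a monomial; at the origin the
  difference quotient is again such a power and tends to 0. They are the building blocks of the test
  functions below.\<close>

lemma DERIV_max_zero_power:
  fixes t :: real
  shows "((\<lambda>t. max 0 t ^ Suc (Suc k)) has_real_derivative real (Suc (Suc k)) * max 0 t ^ Suc k) (at t)"
proof -
  consider "t < 0" | "t > 0" | "t = 0" by linarith
  then show ?thesis
  proof cases
    case 1
    have "((\<lambda>t. max 0 t ^ Suc (Suc k)) has_real_derivative 0) (at t)"
      by (rule has_field_derivative_transform_within_open[where f = "\<lambda>_. 0" and S = "{..<0}"])
        (use 1 in auto)
    with 1 show ?thesis by simp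
  next
    case 2
    have "((\<lambda>t. max 0 t ^ Suc (Suc k)) has_real_derivative real (Suc (Suc k)) * t ^ Suc k) (at t)"
      by (rule has_field_derivative_transform_within_open[where f = "\<lambda>t. t ^ Suc (Suc k)" and S = "{0<..}"])
        (use 2 in \<open>auto intro!: derivative_eq_intros simp del: power_Suc\<close>)
    with 2 show ?thesis by simp
  next
    case 3
    have "(\<lambda>h::real. max 0 h ^ Suc k) \<midarrow>0\<rightarrow> 0"
      by (rule tendsto_eq_intros refl | simp)+
    then have "(\<lambda>h::real. max 0 h ^ Suc (Suc k) / h) \<midarrow>0\<rightarrow> 0"
      by (rule Lim_transform_eventually) (auto simp: eventually_at_filter max_def)
    with 3 show ?thesis by (simp add: DERIV_def)
  qed
qed

text \<open>\<open>q\<close> is positive exactly on the open interval, so the quotient lies in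
  [0,1), vanishes outside and tends to the indicator as \<epsilon> goes to 0. The exponent 3 is the
  least one for which the second derivative is continuous.\<close>

lemma C2c_approximates_interval_indicator:
  assumes "a < b" "\<epsilon> > 0"
  defines "q \<equiv> \<lambda>x::real. max 0 (x - a) ^ 3 * max 0 (b - x) ^ 3"
  shows "(\<lambda>x. q x / (\<epsilon> + q x)) \<in> C2c"
proof -
  define w where "w k t = max 0 t ^ k" for k and t :: real
  have w3: "(w 3 has_real_derivative 3 * w 2 t) (at t)" for t
    using DERIV_max_zero_power[of 1 t] by (simp add: w_def[abs_def] numeral_eq_Suc)
  have w2: "(w 2 has_real_derivative 2 * w 1 t) (at t)" for t
    using DERIV_max_zero_power[of 0 t] by (simp add: w_def[abs_def] numeral_eq_Suc)
  have wc: "continuous_on UNIV (\<lambda>x. w k (h x))" if "continuous_on UNIV h" for k and h :: "real \<Rightarrow> real"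
    unfolding w_def using that by (intro continuous_intros)
  \<comment> \<open>First and second derivative of \<open>q\<close>, by the product rule.\<close>
  define q1 where "q1 x = 3 * w 2 (x - a) * w 3 (b - x) - 3 * w 3 (x - a) * w 2 (b - x)" for x
  define q2 where "q2 x = 6 * w 1 (x - a) * w 3 (b - x) - 18 * w 2 (x - a) * w 2 (b - x)
      + 6 * w 3 (x - a) * w 1 (b - x)" for x
  have qw: "q = (\<lambda>x. w 3 (x - a) * w 3 (b - x))" by (simp add: q_def w_def)
  have w3': "((\<lambda>x. w 3 (h x)) has_real_derivative 3 * w 2 (h x) * h') (at x)"
    if "(h has_real_derivative h') (at x)" for h h' x
    using DERIV_chain2[OF w3 that] by simp
  have w2': "((\<lambda>x. w 2 (h x)) has_real_derivative 2 * w 1 (h x) * h') (at x)"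
    if "(h has_real_derivative h') (at x)" for h h' x
    using DERIV_chain2[OF w2 that] by simp
  have q: "(q has_real_derivative q1 x) (at x)" for x
    unfolding qw q1_def by (auto intro!: derivative_eq_intros w3')
  have q1: "(q1 has_real_derivative q2 x) (at x)" for x
    unfolding q1_def[abs_def] q2_def by (auto intro!: derivative_eq_intros w3' w2' simp: algebra_simps)
  have pos: "\<epsilon> + q x > 0" for x using \<open>\<epsilon> > 0\<close> by (simp add: q_def add_pos_nonneg)
  then have nz: "\<epsilon> + q x \<noteq> 0" for x by (simp add: less_imp_neq[symmetric])
  show ?thesis
  proof (rule C2cI)
    show "((\<lambda>x. q x / (\<epsilon> + q x)) has_real_derivative \<epsilon> * q1 x / (\<epsilon> + q x)^2) (at x)" for x
      using nz[of x]
      by (auto intro!: derivative_eq_intros q simp: field_simps power2_eq_square)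
    show "((\<lambda>x. \<epsilon> * q1 x / (\<epsilon> + q x)^2) has_real_derivative
        \<epsilon> * q2 x / (\<epsilon> + q x)^2 - 2 * \<epsilon> * (q1 x)\<^sup>2 / (\<epsilon> + q x)^3) (at x)" for x
      using nz[of x]
      by (auto intro!: derivative_eq_intros q q1 simp: divide_simps power2_eq_square power3_eq_cube)
        (simp add: algebra_simps)
    have "continuous_on UNIV q" "continuous_on UNIV q1"
      using q q1 by (meson DERIV_isCont continuous_at_imp_continuous_on)+
    moreover have "continuous_on UNIV q2"
      unfolding q2_def by (intro continuous_intros wc)
    ultimately show "continuous_on UNIV (\<lambda>x. \<epsilon> * q2 x / (\<epsilon> + q x)^2 - 2 * \<epsilon> * (q1 x)\<^sup>2 / (\<epsilon> + q x)^3)"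
      by (intro continuous_intros) (auto simp: nz)
    show "q x / (\<epsilon> + q x) = 0" if "max \<bar>a\<bar> \<bar>b\<bar> < \<bar>x\<bar>" for x
      using that \<open>a < b\<close> by (auto simp: q_def max_def split: if_splits)
  qed
qed

text \<open>After cutting to a bounded interval, the positive and the negative part of
  \<open>r\<close> are densities of two finite measures that agree on all half lines. The measures
  therefore coincide, and so do their densities.\<close>

lemma integral_zero_on_intervals_imp_AE_zero:
  fixes r :: "real \<Rightarrow> real"
  assumes r: "\<And>a b. set_integrable lebesgue {a..b} r"
    and z: "\<And>a b. a < b \<Longrightarrow> (LINT x:{a<..<b}|lebesgue. r x) = 0"
  shows "AE x in lebesgue. r x = 0"
proof -
  have "AE x in lebesgue. indicator {- real N..real N} x * r x = 0" for N :: nat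
  proof -
    let ?r = "\<lambda>x. indicator {- real N..real N} x * r x"
    have ir: "integrable lebesgue ?r"
      using r[of "- real N" "real N"] by (simp add: set_integrable_def)
    then obtain r' where [measurable]: "r' \<in> borel_measurable lborel"
      and AE1: "AE x in lborel. ?r x = r' x"
      using completion_ex_borel_measurable_real[of ?r] by blast
    have AE: "AE x in lebesgue. ?r x = r' x" using AE1 by (rule AE_completion)
    have r'L: "r' \<in> borel_measurable lebesgue" by (intro measurable_completion) auto
    have "integrable lebesgue r'"
      by (rule integrable_cong_AE_imp[OF ir r'L]) (use AE in auto)
    then have ir': "integrable lborel r'" by (simp add: integrable_completion)
    \<comment> \<open>The half line meets the cut-off interval in an open interval, up to endpoints
      of measure zero.\<close>
    have z': "(\<integral>y. indicator {x<..} y * r' y \<partial>lborel) = 0" for x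
    proof -
      have "(\<integral>y. indicator {x<..} y * r' y \<partial>lborel) = (\<integral>y. indicator {x<..} y * r' y \<partial>lebesgue)"
        by (intro integral_completion[symmetric]) auto
      also have "\<dots> = (LINT y:{max x (- real N)<..<real N}|lebesgue. r y)"
        unfolding set_lebesgue_integral_def
      proof (rule integral_cong_AE)
        show "(\<lambda>y. indicator {x<..} y * r' y) \<in> borel_measurable lebesgue"
          by (intro measurable_completion) auto
        have "set_integrable lebesgue {max x (- real N)<..<real N} r"
          by (rule set_integrable_subset[OF r[of "max x (- real N)" "real N"]]) auto
        then show "(\<lambda>y. indicator {max x (- real N)<..<real N} y *\<^sub>R r y) \<in> borel_measurable lebesgue"
          by (auto simp: set_integrable_def)
        have "AE y in lebesgue. y \<noteq> real N" "AE y in lebesgue. y \<noteq> - real N"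
          by (auto intro!: AE_completion AE_lborel_singleton)
        then show "AE y in lebesgue. indicator {x<..} y * r' y
            = indicator {max x (- real N)<..<real N} y *\<^sub>R r y"
          using AE by eventually_elim (auto simp: indicator_def of_bool_def split: if_splits)
      qed
      also have "\<dots> = 0"
        using z[of "max x (- real N)" "real N"]
        by (cases "max x (- real N) < real N") (auto simp: set_lebesgue_integral_def)
      finally show ?thesis .
    qed
    \<comment> \<open>Finiteness allows the vanishing difference of the two nonnegative integrals to
      be read as their equality in \<open>ennreal\<close>.\<close>
    have fin: "(\<integral>\<^sup>+y. ennreal (indicator {x<..} y * r' y) \<partial>lborel) < \<infinity>"
      "(\<integral>\<^sup>+y. ennreal (- (indicator {x<..} y * r' y)) \<partial>lborel) < \<infinity>"
      and eq: "(\<integral>\<^sup>+y. ennreal (indicator {x<..} y * r' y) \<partial>lborel)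
        = (\<integral>\<^sup>+y. ennreal (- (indicator {x<..} y * r' y)) \<partial>lborel)" for x
    proof -
      have i: "integrable lborel (\<lambda>y. indicator {x<..} y * r' y)"
        using integrable_mult_indicator[of "{x<..}" lborel r'] ir' by simp
      show f: "(\<integral>\<^sup>+y. ennreal (indicator {x<..} y * r' y) \<partial>lborel) < \<infinity>"
        "(\<integral>\<^sup>+y. ennreal (- (indicator {x<..} y * r' y)) \<partial>lborel) < \<infinity>"
        using i unfolding real_integrable_def by (auto simp: less_top)
      show "(\<integral>\<^sup>+y. ennreal (indicator {x<..} y * r' y) \<partial>lborel)
        = (\<integral>\<^sup>+y. ennreal (- (indicator {x<..} y * r' y)) \<partial>lborel)"
        using real_lebesgue_integral_def[OF i] z'[of x] f
        by (metis diff_eq_diff_eq diff_self ennreal_enn2real infinity_ennreal_def)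
    qed
    have "density lborel (\<lambda>x. ennreal (r' x)) = density lborel (\<lambda>x. ennreal (- r' x))"
    proof (rule measure_eqI_lessThan)
      have *: "ennreal (c y) * indicator {x<..} y = ennreal (indicator {x<..} y * c y)"
        "ennreal (- c y) * indicator {x<..} y = ennreal (- (indicator {x<..} y * c y))"
        for x y and c :: "real \<Rightarrow> real" by (auto simp: indicator_def)
      have e1: "emeasure (density lborel (\<lambda>x. ennreal (r' x))) {x<..}
        = (\<integral>\<^sup>+y. ennreal (indicator {x<..} y * r' y) \<partial>lborel)" for x
        by (simp add: emeasure_density *)
      have e2: "emeasure (density lborel (\<lambda>x. ennreal (- r' x))) {x<..}
        = (\<integral>\<^sup>+y. ennreal (- (indicator {x<..} y * r' y)) \<partial>lborel)" for x
        by (simp add: emeasure_density *)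
      show "emeasure (density lborel (\<lambda>x. ennreal (r' x))) {x<..} < \<infinity>" for x
        unfolding e1 by (rule fin)
      show "emeasure (density lborel (\<lambda>x. ennreal (r' x))) {x<..}
        = emeasure (density lborel (\<lambda>x. ennreal (- r' x))) {x<..}" for x
        unfolding e1 e2 by (rule eq)
    qed auto
    then have "AE x in lborel. ennreal (r' x) = ennreal (- r' x)"
      by (intro sigma_finite_measure.density_unique[OF sigma_finite_lborel]) auto
    \<comment> \<open>\<open>ennreal\<close> sends negative numbers to 0, so the two sides are the
      positive and the negative part of \<open>r' x\<close>; at most one of them is nonzero, hence
      both vanish.\<close>
    then have "AE x in lborel. r' x = 0"
    proof eventually_elim
      case (elim x)
      then show ?case
        by (cases "r' x \<ge> 0") (auto simp: ennreal_eq_0_iff ennreal_neg)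
    qed
    then have "AE x in lebesgue. r' x = 0" by (rule AE_completion)
    with AE show ?thesis by eventually_elim auto
  qed
  then have "AE x in lebesgue. \<forall>N::nat. indicator {- real N..real N} x * r x = 0"
    by (intro AE_all_countable[THEN iffD2] allI)
  then show ?thesis
  proof eventually_elim
    case (elim x)
    obtain N :: nat where "\<bar>x\<bar> \<le> real N" using real_arch_simple by blast
    then have "x \<in> {- real N..real N}" by auto
    with elim show ?case by (metis indicator_simps(1) mult_1)
  qed
qed

text \<open>The functions \<phi> \<open>n\<close> below increase to the indicator of an open
  interval, and \<open>|r|\<close> on the closed interval dominates the products. Dominated
  convergence reduces the claim to vanishing integrals over intervals.\<close>

lemma fundamental_lemma_calculus_of_variations:
  fixes r :: "real \<Rightarrow> real"
  assumes r: "\<And>a b. set_integrable lebesgue {a..b} r"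
    and z: "\<And>\<phi>. \<phi> \<in> C2c \<Longrightarrow> (LINT x|lebesgue. \<phi> x * r x) = 0"
  shows "AE x in lebesgue. r x = 0"
proof (rule integral_zero_on_intervals_imp_AE_zero[OF r])
  fix a b :: real assume "a < b"
  define q where "q x = max 0 (x - a) ^ 3 * max 0 (b - x) ^ 3" for x :: real
  define \<phi> where "\<phi> n x = q x / (1 / real (Suc n) + q x)" for n x
  have \<phi>C: "\<phi> n \<in> C2c" for n
    using C2c_approximates_interval_indicator[OF \<open>a < b\<close>, of "1 / real (Suc n)"]
    by (simp add: \<phi>_def[abs_def] q_def)
  have q0: "q x \<ge> 0" for x by (simp add: q_def)
  have qz: "q x = 0" if "x \<notin> {a<..<b}" for x using that by (auto simp: q_def)
  have qp: "q x > 0" if "x \<in> {a<..<b}" for x using that by (auto simp: q_def)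
  let ?s = "\<lambda>n x. \<phi> n x * r x"
  have "continuous_on UNIV q" unfolding q_def by (intro continuous_intros)
  then have [measurable]: "q \<in> borel_measurable borel" by (rule borel_measurable_continuous_onI)
  have [measurable]: "q \<in> borel_measurable lebesgue" by (intro measurable_completion) auto
  have rm: "(\<lambda>x. indicator {a..b} x * r x) \<in> borel_measurable lebesgue"
    using r[of a b] by (auto simp: set_integrable_def)
  \<comment> \<open>Measurability of \<open>r\<close> is supplied on bounded intervals; inserting
    the indicator changes nothing because \<open>\<phi> n\<close> vanishes outside the open
    interval.\<close>
  have eqs: "?s n = (\<lambda>x. \<phi> n x * (indicator {a..b} x * r x))" for n
  proof
    show "?s n x = \<phi> n x * (indicator {a..b} x * r x)" for x
      by (cases "x \<in> {a<..<b}") (auto simp: \<phi>_def qz indicator_def)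
  qed
  have im: "(\<lambda>x. indicator {a<..<b} x * r x) \<in> borel_measurable lebesgue"
    using borel_measurable_integrable[OF set_integrable_subset[OF r[of a b], of "{a<..<b}",
      unfolded set_integrable_def]] by (simp add: subset_eq)
  have "(\<lambda>n. LINT x|lebesgue. ?s n x) \<longlonglongrightarrow> (LINT x|lebesgue. indicator {a<..<b} x * r x)"
  proof (rule integral_dominated_convergence)
    show "(\<lambda>x. indicator {a<..<b} x * r x) \<in> borel_measurable lebesgue" by (fact im)
    show "?s n \<in> borel_measurable lebesgue" for n
      unfolding eqs by (intro borel_measurable_times rm measurable_completion) (simp add: \<phi>_def)
    show "integrable lebesgue (\<lambda>x. \<bar>indicator {a..b} x * r x\<bar>)"
      using r[of a b] by (auto simp: set_integrable_def)
    have \<phi>1: "\<bar>\<phi> n x\<bar> \<le> 1" for n x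
    proof -
      have "0 < 1 / real (Suc n) + q x" using q0[of x] by (intro add_pos_nonneg) auto
      then show ?thesis using q0[of x] by (simp add: \<phi>_def)
    qed
    have "norm (?s n x) \<le> \<bar>indicator {a..b} x * r x\<bar>" for n x
      unfolding fun_cong[OF eqs, of n x] real_norm_def abs_mult[of "\<phi> n x"]
      by (intro mult_left_le_one_le \<phi>1) auto
    then show "AE x in lebesgue. norm (?s n x) \<le> \<bar>indicator {a..b} x * r x\<bar>" for n
      by auto
    have "(\<lambda>n. \<phi> n x) \<longlonglongrightarrow> indicator {a<..<b} x" for x
    proof (cases "x \<in> {a<..<b}")
      case True
      have "(\<lambda>n. q x / (1 / real (Suc n) + q x)) \<longlonglongrightarrow> q x / (0 + q x)"
        using qp[OF True] by (intro tendsto_intros LIMSEQ_Suc[OF lim_1_over_n]) auto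
      with qp[OF True] True show ?thesis by (simp add: \<phi>_def)
    qed (auto simp: \<phi>_def qz)
    then show "AE x in lebesgue. (\<lambda>n. ?s n x) \<longlonglongrightarrow> indicator {a<..<b} x * r x"
      by (auto intro!: tendsto_intros)
  qed
  then have "(LINT x|lebesgue. indicator {a<..<b} x * r x) = 0"
    using z[OF \<phi>C] by (simp add: LIMSEQ_const_iff)
  then show "(LINT x:{a<..<b}|lebesgue. r x) = 0" by (simp add: set_lebesgue_integral_def)
qed

section \<open>The initial condition\<close>

text \<open>Right continuity of the paths at 0 gives \<open>X t\<close> \<rightarrow>
  \<open>x0\<close> almost surely, and bounded convergence carries this over to the expectations of
  \<open>h (X t)\<close>, which are the integrals of \<open>h\<close> against the densities.\<close>

lemma sde_solution_dirac_initial: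
  assumes sol: "sde_solution M F B L \<alpha> \<beta> f g \<sigma> x0 X" and dens: "has_densities M X p"
  shows "dirac_initial p x0"
  unfolding dirac_initial_def
proof (intro allI impI, elim conjE)
  fix h :: "real \<Rightarrow> real"
  assume ch: "continuous_on UNIV h" and bh: "bounded (range h)"
  interpret prob_space M using sol by (simp add: sde_solution_def)
  have [measurable]: "h \<in> borel_measurable borel" using ch by (rule borel_measurable_continuous_onI)
  obtain C where C: "\<And>x. \<bar>h x\<bar> \<le> C" using bh by (auto simp: bounded_iff)
  have cadlag: "AE \<omega> in M. cadlag (\<lambda>t. X t \<omega>)" and init: "AE \<omega> in M. X 0 \<omega> = x0"
    using sol by (auto simp: sde_solution_def)
  have Xm: "X t \<in> borel_measurable M" and
    Xi: "(LINT x|lborel. h x * p t x) = (LINT \<omega>|M. h (X t \<omega>))" if "t > 0" for t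
  proof -
    have D: "distributed M lborel (X t) (\<lambda>x. ennreal (p t x))" and "\<And>x. 0 \<le> p t x"
      using dens that by (auto simp: has_densities_def)
    show "X t \<in> borel_measurable M" using distributed_measurable[OF D] by simp
    show "(LINT x|lborel. h x * p t x) = (LINT \<omega>|M. h (X t \<omega>))"
      using distributed_integral[OF D, of h] \<open>\<And>x. 0 \<le> p t x\<close> by (simp add: mult.commute)
  qed
  \<comment> \<open>Dominated convergence is applied along sequences decreasing to 0; the upper
    bound 1 for their terms is arbitrary.\<close>
  show "((\<lambda>t. LINT x|lborel. h x * p t x) \<longlongrightarrow> h x0) (at_right 0)"
  proof (rule tendsto_at_right_sequentially[of 0 1])
    fix S :: "nat \<Rightarrow> real"
    assume S: "\<And>n. 0 < S n" "\<And>n. S n < 1" "decseq S" "S \<longlonglongrightarrow> 0"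
    have Sr: "filterlim S (at_right 0) sequentially"
      using S by (auto simp: filterlim_at less_imp_neq[symmetric])
    have "(\<lambda>n. LINT \<omega>|M. h (X (S n) \<omega>)) \<longlonglongrightarrow> (LINT \<omega>|M. h x0)"
    proof (rule integral_dominated_convergence[where w = "\<lambda>_. C"])
      show "(\<lambda>\<omega>. h (X (S n) \<omega>)) \<in> borel_measurable M" for n
        using Xm[OF S(1)] by measurable
      show "AE \<omega> in M. (\<lambda>n. h (X (S n) \<omega>)) \<longlonglongrightarrow> h x0"
        using cadlag init
      proof eventually_elim
        case (elim \<omega>)
        then have "((\<lambda>t. X t \<omega>) \<longlongrightarrow> x0) (at_right 0)"
          by (auto simp: cadlag_def continuous_within)
        then have "(\<lambda>n. X (S n) \<omega>) \<longlonglongrightarrow> x0" using Sr by (rule filterlim_compose)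
        moreover have "isCont h x0" using ch by (simp add: continuous_on_eq_continuous_at)
        ultimately show ?case by (rule isCont_tendsto_compose[rotated])
      qed
    qed (use C in auto)
    then show "(\<lambda>n. LINT x|lborel. h x * p (S n) x) \<longlonglongrightarrow> h x0"
      using Xi[OF S(1)] by (simp add: prob_space)
  qed simp
qed

section \<open>The density of the stable Levy measure\<close>

text \<open>A real-valued density turns integrals against \<open>nu\<close> into integrals over
  \<open>lborel\<close>, where translation, reflection, scaling and Fubini's theorem apply
  directly.\<close>

definition stable_kernel :: "real \<Rightarrow> real \<Rightarrow> real \<Rightarrow> real" where
  "stable_kernel \<alpha> \<beta> z =
     (C_pos \<alpha> \<beta> * indicator {0<..} z + C_neg \<alpha> \<beta> * indicator {..<0} z) / \<bar>z\<bar> powr (1 + \<alpha>)"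

lemma nu_eq_density: "nu \<alpha> \<beta> = density lborel (\<lambda>z. ennreal (stable_kernel \<alpha> \<beta> z))"
  by (simp add: nu_def stable_kernel_def)

lemma stable_kernel_measurable[measurable]: "stable_kernel \<alpha> \<beta> \<in> borel_measurable borel"
  unfolding stable_kernel_def by measurable

lemma stable_kernel_0[simp]: "stable_kernel \<alpha> \<beta> 0 = 0"
  by (simp add: stable_kernel_def)

lemma stable_kernel_uminus: "stable_kernel \<alpha> (- \<beta>) z = stable_kernel \<alpha> \<beta> (- z)"
  by (auto simp: stable_kernel_def C_pos_def C_neg_def indicator_def)

text \<open>Both \<open>1 - \<alpha>\<close> and the cosine change sign at \<alpha> = 1, so their
  quotient stays positive. For \<alpha> > 1 the cosine is reflected at a right angle.\<close>

lemma C_stable_pos: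
  assumes "0 < \<alpha>" "\<alpha> < 2"
  shows "C_stable \<alpha> > 0"
proof -
  consider "\<alpha> = 1" | "\<alpha> < 1" | "\<alpha> > 1" by linarith
  then show ?thesis
  proof cases
    case 2
    have "cos (pi * \<alpha> / 2) > 0"
      by (rule cos_gt_zero_pi) (use assms 2 in \<open>auto simp: field_simps intro: less_trans[of _ 0]\<close>)
    with 2 assms show ?thesis by (simp add: C_stable_def Gamma_real_pos)
  next
    case 3
    have "pi * (2 - \<alpha>) < pi * 1" by (rule mult_strict_left_mono) (use 3 in auto)
    moreover have "pi * (2 - \<alpha>) > 0" using assms by simp
    ultimately have "cos (pi - pi * \<alpha> / 2) > 0"
      by (intro cos_gt_zero_pi) (auto simp: algebra_simps)
    then have "cos (pi * \<alpha> / 2) < 0" by (simp add: cos_pi_minus)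
    with 3 assms show ?thesis
      by (simp add: C_stable_def Gamma_real_pos divide_neg_neg mult_pos_neg)
  qed (simp add: C_stable_def)
qed

lemma stable_kernel_nonneg:
  assumes "0 < \<alpha>" "\<alpha> < 2" "- 1 < \<beta>" "\<beta> < 1"
  shows "stable_kernel \<alpha> \<beta> z \<ge> 0"
  using C_stable_pos[OF assms(1,2)] assms(3,4)
  by (auto simp: stable_kernel_def C_pos_def C_neg_def indicator_def)

lemma stable_kernel_le:
  assumes "0 < \<alpha>" "\<alpha> < 2" "- 1 < \<beta>" "\<beta> < 1"
  shows "stable_kernel \<alpha> \<beta> z \<le> C_stable \<alpha> / \<bar>z\<bar> powr (1 + \<alpha>)"
proof -
  have "C_stable \<alpha> * (1 + \<beta>) / 2 \<le> C_stable \<alpha> * 2 / 2" "C_stable \<alpha> * (1 - \<beta>) / 2 \<le> C_stable \<alpha> * 2 / 2"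
    using C_stable_pos[OF assms(1,2)] assms(3,4)
    by (intro divide_right_mono mult_left_mono; simp)+
  then have "C_pos \<alpha> \<beta> * indicator {0<..} z + C_neg \<alpha> \<beta> * indicator {..<0} z \<le> C_stable \<alpha>"
    using C_stable_pos[OF assms(1,2)]
    by (cases z "0 :: real" rule: linorder_cases) (simp_all add: C_pos_def C_neg_def)
  then show ?thesis
    unfolding stable_kernel_def by (intro divide_right_mono) auto
qed

text \<open>The kernel is homogeneous of degree \<open>-(1 + \<alpha>)\<close>, and a negative
  factor exchanges the two half lines, that is, the sign of the skewness.\<close>

lemma stable_kernel_scale:
  assumes "c \<noteq> 0"
  shows "\<bar>c\<bar> * stable_kernel \<alpha> (sgn c * \<beta>) (c * y) = stable_kernel \<alpha> \<beta> y / \<bar>c\<bar> powr \<alpha>"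
proof -
  have "\<bar>c * y\<bar> powr (1 + \<alpha>) = \<bar>c\<bar> * \<bar>c\<bar> powr \<alpha> * \<bar>y\<bar> powr (1 + \<alpha>)"
    using assms by (simp add: abs_mult powr_mult powr_add)
  with assms show ?thesis
    by (cases "c > 0")
      (auto simp: stable_kernel_def C_pos_def C_neg_def indicator_def zero_less_mult_iff mult_less_0_iff)
qed

lemma stable_kernel_integral_scale:
  assumes "c \<noteq> 0"
  shows "(LINT y|lborel. F (c * y) * stable_kernel \<alpha> \<beta> y)
       = \<bar>c\<bar> powr \<alpha> * (LINT z|lborel. F z * stable_kernel \<alpha> (sgn c * \<beta>) z)"
proof -
  have "(LINT z|lborel. F z * stable_kernel \<alpha> (sgn c * \<beta>) z)
      = \<bar>c\<bar> * (LINT y|lborel. F (c * y) * stable_kernel \<alpha> (sgn c * \<beta>) (c * y))"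
    using lborel_integral_real_affine[OF assms, of "\<lambda>z. F z * stable_kernel \<alpha> (sgn c * \<beta>) z" 0] by simp
  also have "\<dots> = (LINT y|lborel. F (c * y) * (\<bar>c\<bar> * stable_kernel \<alpha> (sgn c * \<beta>) (c * y)))"
    by (simp add: mult_ac flip: integral_mult_right_zero)
  also have "\<dots> = (LINT y|lborel. F (c * y) * stable_kernel \<alpha> \<beta> y) / \<bar>c\<bar> powr \<alpha>"
    by (simp add: stable_kernel_scale[OF assms])
  finally show ?thesis using assms by simp
qed

text \<open>The kernel vanishes at 0, so removing the origin leaves no trace on the right.\<close>

lemma LINT_nu:
  assumes "0 < \<alpha>" "\<alpha> < 2" "- 1 < \<beta>" "\<beta> < 1" and [measurable]: "F \<in> borel_measurable borel"
  shows "(LINT z:-{0}|nu \<alpha> \<beta>. F z) = (LINT z|lborel. F z * stable_kernel \<alpha> \<beta> z)"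
proof -
  have "(LINT z:-{0}|nu \<alpha> \<beta>. F z)
      = (LINT z|lborel. stable_kernel \<alpha> \<beta> z *\<^sub>R (indicator (-{0}) z *\<^sub>R F z))"
    unfolding set_lebesgue_integral_def nu_eq_density
    by (intro integral_density) (auto simp: stable_kernel_nonneg assms)
  also have "\<dots> = (LINT z|lborel. F z * stable_kernel \<alpha> \<beta> z)"
    by (intro Bochner_Integration.integral_cong) (auto simp: indicator_def)
  finally show ?thesis .
qed

lemma sigma_finite_nu: "sigma_finite_measure (nu \<alpha> \<beta>)"
  unfolding nu_eq_density by (subst sigma_finite_measure.sigma_finite_iff_density_finite[OF sigma_finite_lborel]) auto

text \<open>The first conclusion feeds Fubini's theorem. The second keeps the Borel measurability
  that the integrability hypothesis carries; the measurability of a derivative is later extracted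
  from it.\<close>

lemma set_integrable_lborel_nuD:
  assumes "0 < \<alpha>" "\<alpha> < 2" "- 1 < \<beta>" "\<beta> < 1"
    and "set_integrable (lborel \<Otimes>\<^sub>M nu \<alpha> \<beta>) (A \<times> (-{0})) F"
  shows "integrable (lborel \<Otimes>\<^sub>M lborel) (\<lambda>(x, z). indicator A x * F (x, z) * stable_kernel \<alpha> \<beta> z)"
    and "(\<lambda>(x, z). indicator A x * indicator (-{0}) z * F (x, z)) \<in> borel_measurable (borel \<Otimes>\<^sub>M borel)"
proof -
  let ?G = "\<lambda>p. indicator (A \<times> (-{0})) p *\<^sub>R F p"
  have eq: "lborel \<Otimes>\<^sub>M nu \<alpha> \<beta>
      = density (lborel \<Otimes>\<^sub>M lborel) (\<lambda>p. ennreal (stable_kernel \<alpha> \<beta> (snd p)))"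
  proof -
    have "density lborel (\<lambda>_. 1) \<Otimes>\<^sub>M nu \<alpha> \<beta>
      = density (lborel \<Otimes>\<^sub>M lborel) (\<lambda>(x, z). 1 * ennreal (stable_kernel \<alpha> \<beta> z))"
      unfolding nu_eq_density
      by (rule pair_measure_density)
        (use sigma_finite_nu in \<open>auto simp: nu_eq_density sigma_finite_lborel\<close>)
    then show ?thesis by (simp add: density_1 case_prod_unfold)
  qed
  have i: "integrable (density (lborel \<Otimes>\<^sub>M lborel) (\<lambda>p. ennreal (stable_kernel \<alpha> \<beta> (snd p)))) ?G"
    using assms(5) unfolding set_integrable_def eq .
  then have m: "?G \<in> borel_measurable (lborel \<Otimes>\<^sub>M lborel)"
    using borel_measurable_integrable[OF i] by simp
  have "integrable (lborel \<Otimes>\<^sub>M lborel) (\<lambda>p. stable_kernel \<alpha> \<beta> (snd p) *\<^sub>R ?G p)"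
    by (rule integrable_density[THEN iffD1, OF m _ _ i])
      (auto simp: stable_kernel_nonneg assms)
  then show "integrable (lborel \<Otimes>\<^sub>M lborel) (\<lambda>(x, z). indicator A x * F (x, z) * stable_kernel \<alpha> \<beta> z)"
    by (rule Bochner_Integration.integrable_cong[THEN iffD1, rotated 2])
      (auto simp: indicator_def)
  have "?G = (\<lambda>(x, z). indicator A x * indicator (-{0}) z * F (x, z))"
    by (auto simp: indicator_def)
  with m show "(\<lambda>(x, z). indicator A x * indicator (-{0}) z * F (x, z))
      \<in> borel_measurable (borel \<Otimes>\<^sub>M borel)"
    by simp
qed

text \<open>Near 0 the function is \<open>z powr (1 - \<alpha>)\<close>, integrable because \<alpha>
  < 2; beyond 1 it is \<open>z powr (-1 - \<alpha>)\<close>, integrable because \<alpha> > 0.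
  Reflection covers the negative half line.\<close>

lemma integrable_min_1_square_powr:
  assumes "0 < \<alpha>" "\<alpha> < (2::real)"
  shows "integrable lborel (\<lambda>z::real. min 1 (z\<^sup>2) / \<bar>z\<bar> powr (1 + \<alpha>))"
proof -
  let ?m = "\<lambda>z::real. min 1 (z\<^sup>2) / \<bar>z\<bar> powr (1 + \<alpha>)"
  have "(\<lambda>z. z powr (1 - \<alpha>)) integrable_on {0..1}"
    by (rule integrable_on_powr_from_0) (use assms in auto)
  then have "?m integrable_on {0..1}"
  proof (rule integrable_eq)
    fix z :: real assume z: "z \<in> {0..1}"
    have "z powr (1 - \<alpha>) = z powr 2 / z powr (1 + \<alpha>)" using powr_diff[of z 2 "1 + \<alpha>"] by simp
    with z show "z powr (1 - \<alpha>) = ?m z"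
      using power_le_one[of z 2] by (cases "z = 0") (auto simp: min_def)
  qed
  then have i1: "set_integrable lebesgue {0..1} ?m"
    by (rule nonnegative_absolutely_integrable_1) auto
  have "(\<lambda>z. z powr (-1 - \<alpha>)) integrable_on {1..}"
    using has_integral_powr_to_inf[of "-1 - \<alpha>" 1] assms by (auto simp: integrable_on_def)
  then have "?m integrable_on {1..}"
  proof (rule integrable_eq)
    fix z :: real assume z: "z \<in> {1..}"
    then show "z powr (-1 - \<alpha>) = ?m z"
      using one_le_power[of z 2] powr_minus_divide[of z "1 + \<alpha>"] by simp
  qed
  then have i2: "set_integrable lebesgue {1..} ?m"
    by (rule nonnegative_absolutely_integrable_1) auto
  have "set_integrable lebesgue ({0..1} \<union> {1..}) ?m"
    by (rule set_integrable_Un[OF i1 i2]) auto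
  moreover have "{0..1} \<union> {1..} = {0::real..}" by auto
  ultimately have i: "integrable lborel (\<lambda>z. indicator {0..} z * ?m z)"
    by (simp add: set_integrable_def integrable_completion)
  have "integrable lborel (\<lambda>z. indicator {0..} (0 + (-1) * z) * ?m (0 + (-1) * z))"
    by (rule lborel_integrable_real_affine[OF i]) simp
  with i have "integrable lborel (\<lambda>z. indicator {0..} z * ?m z + indicator {0..} (- z) * ?m z)"
    by simp
  then show ?thesis
    by (rule Bochner_Integration.integrable_cong[THEN iffD1, rotated 2]) (auto simp: indicator_def)
qed

lemma integrable_min_1_square_stable_kernel:
  assumes "0 < \<alpha>" "\<alpha> < 2" "- 1 < \<beta>" "\<beta> < 1"
  shows "integrable lborel (\<lambda>z. min 1 (z\<^sup>2) * stable_kernel \<alpha> \<beta> z)"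
proof (rule Bochner_Integration.integrable_bound)
  show "integrable lborel (\<lambda>z. C_stable \<alpha> * (min 1 (z\<^sup>2) / \<bar>z\<bar> powr (1 + \<alpha>)))"
    by (intro integrable_mult_right integrable_min_1_square_powr assms)
  have "norm (min 1 (z\<^sup>2) * stable_kernel \<alpha> \<beta> z)
      \<le> norm (C_stable \<alpha> * (min 1 (z\<^sup>2) / \<bar>z\<bar> powr (1 + \<alpha>)))" for z
    using mult_left_mono[OF stable_kernel_le[OF assms, of z], of "min 1 (z\<^sup>2)"]
      stable_kernel_nonneg[OF assms, of z] C_stable_pos[OF assms(1,2)]
    by (simp add: abs_mult mult_ac)
  then show "AE z in lborel. norm (min 1 (z\<^sup>2) * stable_kernel \<alpha> \<beta> z)
      \<le> norm (C_stable \<alpha> * (min 1 (z\<^sup>2) / \<bar>z\<bar> powr (1 + \<alpha>)))" by simp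
qed measurable

section \<open>Bounds for the nonlocal operator\<close>

text \<open>One form for both sides of the duality: \<open>h\<close> is the test function in the
  generator and \<open>|\<sigma>| powr \<alpha> * v\<close> in the explicit operator.\<close>

definition compensated_increment :: "(real \<Rightarrow> real) \<Rightarrow> (real \<Rightarrow> real) \<Rightarrow> real \<Rightarrow> real \<Rightarrow> real" where
  "compensated_increment h s x z = h (x + z) - h x - deriv h x * z * indicator {z. \<bar>z\<bar> < s x} z"

lemma Q_integrand_eq:
  "Q_integrand \<alpha> \<sigma> v = compensated_increment (\<lambda>x. \<bar>\<sigma> x\<bar> powr \<alpha> * v x) (\<lambda>x. \<bar>\<sigma> x\<bar>)"
  by (simp add: Q_integrand_def compensated_increment_def fun_eq_iff)

lemma compensated_increment_measurable:
  assumes [measurable]: "h \<in> borel_measurable borel" "deriv h \<in> borel_measurable borel"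
    "s \<in> borel_measurable borel"
  shows "(\<lambda>(x, z). compensated_increment h s x z) \<in> borel_measurable (borel \<Otimes>\<^sub>M borel)"
  unfolding compensated_increment_def indicator_def mem_Collect_eq by measurable

text \<open>The mean value bound is used twice, first for the derivative and then for the function
  minus its tangent; this gives the constant \<open>M\<close> in place of the sharp
  \<open>M / 2\<close>.\<close>

lemma taylor_bound_second_order:
  assumes D1: "\<And>x. (\<phi> has_real_derivative \<phi>' x) (at x)"
    and D2: "\<And>x. (\<phi>' has_real_derivative \<phi>'' x) (at x)"
    and M: "\<And>x. \<bar>\<phi>'' x\<bar> \<le> M"
  shows "\<bar>\<phi> (x + z) - \<phi> x - \<phi>' x * z\<bar> \<le> M * z\<^sup>2"
proof -
  have 1: "\<bar>\<phi>' (x + t) - \<phi>' x\<bar> \<le> M * \<bar>t\<bar>" for t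
    using field_differentiable_bound[of UNIV \<phi>' \<phi>'' M "x + t" x] D2 M by auto
  have M0: "M \<ge> 0" using M[of 0] by linarith
  have "norm ((\<lambda>t. \<phi> (x + t) - \<phi>' x * t) z - (\<lambda>t. \<phi> (x + t) - \<phi>' x * t) 0) \<le> M * \<bar>z\<bar> * norm (z - 0)"
  proof (rule field_differentiable_bound[of "{-\<bar>z\<bar>..\<bar>z\<bar>}" _ "\<lambda>t. \<phi>' (x + t) - \<phi>' x"])
    fix t assume t: "t \<in> {-\<bar>z\<bar>..\<bar>z\<bar>}"
    have "((\<lambda>t. \<phi> (x + t) - \<phi>' x * t) has_real_derivative \<phi>' (x + t) - \<phi>' x) (at t)"
      using DERIV_shift[of \<phi> "\<phi>' (x + t)" t x] D1[of "x + t"]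
      by (auto intro!: derivative_eq_intros simp: add.commute)
    then show "((\<lambda>t. \<phi> (x + t) - \<phi>' x * t) has_real_derivative \<phi>' (x + t) - \<phi>' x)
        (at t within {-\<bar>z\<bar>..\<bar>z\<bar>})"
      by (rule DERIV_subset) simp
    have "\<bar>t\<bar> \<le> \<bar>z\<bar>" using t by auto
    then show "norm (\<phi>' (x + t) - \<phi>' x) \<le> M * \<bar>z\<bar>"
      using 1[of t] mult_left_mono[of "\<bar>t\<bar>" "\<bar>z\<bar>" M] M0 by simp
  qed auto
  then show ?thesis by (simp add: power2_eq_square algebra_simps)
qed

lemma inverse_1_plus_abs_L2: "(\<lambda>x. D / (1 + \<bar>x\<bar>)) \<in> L2"
proof -
  have i: "integrable lborel (\<lambda>x::real. inverse (1 + x^2))"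
    using integrable_inverse_1_plus_square by (simp add: set_integrable_def einterval_def)
  have "integrable lborel (\<lambda>x. (D / (1 + \<bar>x\<bar>))\<^sup>2)"
  proof (rule Bochner_Integration.integrable_bound)
    show "integrable lborel (\<lambda>x. D\<^sup>2 * inverse (1 + x^2))" using i by simp
    have "(D / (1 + \<bar>x\<bar>))\<^sup>2 \<le> D\<^sup>2 * inverse (1 + x^2)" for x :: real
    proof -
      have "0 < 1 + x\<^sup>2" by (simp add: add_pos_nonneg)
      moreover have "1 + x\<^sup>2 \<le> (1 + \<bar>x\<bar>)\<^sup>2" by (simp add: power2_sum)
      ultimately show ?thesis
        unfolding divide_inverse power_mult_distrib power_inverse by (intro mult_left_mono le_imp_inverse_le) auto
    qed
    then show "AE x in lborel. norm ((D / (1 + \<bar>x\<bar>))\<^sup>2) \<le> norm (D\<^sup>2 * inverse (1 + x^2))"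
      by (auto simp: abs_mult)
  qed measurable
  then show ?thesis
    by (auto simp: L2_def integrable_completion intro!: measurable_completion)
qed

lemma L2_bounded:
  assumes "w \<in> L2" "u \<in> borel_measurable lebesgue" "\<And>x. \<bar>u x\<bar> \<le> w x"
  shows "u \<in> L2"
proof -
  note [measurable] = assms(2)
  have "integrable lebesgue (\<lambda>x. (u x)\<^sup>2)"
  proof (rule Bochner_Integration.integrable_bound)
    show "integrable lebesgue (\<lambda>x. (w x)\<^sup>2)" using assms(1) by (simp add: L2_def)
    have "(u x)\<^sup>2 \<le> (w x)\<^sup>2" for x
      using assms(3)[of x] by (simp add: power2_le_iff_abs_le abs_le_square_iff[symmetric])
    then show "AE x in lebesgue. norm ((u x)\<^sup>2) \<le> norm ((w x)\<^sup>2)" by simp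
  qed measurable
  then show ?thesis using assms(2) by (simp add: L2_def)
qed

locale jump_coefficient =
  fixes \<alpha> b :: real and s s' :: "real \<Rightarrow> real"
  assumes \<alpha>: "0 < \<alpha>" "\<alpha> < 2" and b: "- 1 < b" "b < 1"
    and s_pos: "\<And>x. 0 < s x" and s_mono: "strict_mono s"
    and s_deriv: "\<And>x. (s has_real_derivative s' x) (at x)"
    and s'_cont: "continuous_on UNIV s'"
    and s_growth: "\<exists>A. \<forall>x. s x \<le> A * (1 + \<bar>x\<bar>)"
begin

abbreviation k where "k \<equiv> stable_kernel \<alpha> b"

lemma k_nonneg: "k z \<ge> 0" using stable_kernel_nonneg[OF \<alpha> b] .

lemma s_cont: "continuous_on UNIV s"
  using s_deriv by (meson DERIV_isCont continuous_at_imp_continuous_on)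

lemma s_measurable[measurable]: "s \<in> borel_measurable borel"
  using s_cont by (rule borel_measurable_continuous_onI)

lemma C2c_measurable:
  assumes "\<phi> \<in> C2c"
  shows "\<phi> \<in> borel_measurable borel" "deriv \<phi> \<in> borel_measurable borel"
    "(\<lambda>(x, z). compensated_increment \<phi> s x z) \<in> borel_measurable (borel \<Otimes>\<^sub>M borel)"
proof -
  show "\<phi> \<in> borel_measurable borel" "deriv \<phi> \<in> borel_measurable borel"
    using C2cE[OF assms] borel_measurable_continuous_onI by metis+
  then show "(\<lambda>(x, z). compensated_increment \<phi> s x z) \<in> borel_measurable (borel \<Otimes>\<^sub>M borel)"
    by (rule compensated_increment_measurable) simp
qed

text \<open>On a bounded range of \<open>x\<close> the monotone threshold \<open>s x\<close> lies
  between two positive constants, so Taylor's bound for small jumps and crude bounds for the others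
  can be made uniform in \<open>x\<close>.\<close>

lemma increment_bound_near:
  assumes \<phi>: "\<phi> \<in> C2c"
  obtains D where "D \<ge> 0"
    and "\<And>x z. \<bar>x\<bar> \<le> R \<Longrightarrow> \<bar>compensated_increment \<phi> s x z\<bar> \<le> D * min 1 (z\<^sup>2)"
proof -
  from \<phi> obtain R0 where
    D1: "\<And>x. (\<phi> has_real_derivative deriv \<phi> x) (at x)" and
    D2: "\<And>x. (deriv \<phi> has_real_derivative deriv (deriv \<phi>) x) (at x)" and
    cc: "continuous_on UNIV \<phi>" "continuous_on UNIV (deriv \<phi>)"
      "continuous_on UNIV (deriv (deriv \<phi>))" and
    zz: "\<And>x. R0 \<le> \<bar>x\<bar> \<Longrightarrow> \<phi> x = 0" "\<And>x. R0 \<le> \<bar>x\<bar> \<Longrightarrow> deriv \<phi> x = 0"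
      "\<And>x. R0 \<le> \<bar>x\<bar> \<Longrightarrow> deriv (deriv \<phi>) x = 0"
    by (rule C2cE) blast
  obtain M0 where M0: "M0 \<ge> 0" "\<And>x. \<bar>\<phi> x\<bar> \<le> M0"
    using continuous_compact_support_bounded[OF cc(1) zz(1)] by blast
  obtain M1 where M1: "M1 \<ge> 0" "\<And>x. \<bar>deriv \<phi> x\<bar> \<le> M1"
    using continuous_compact_support_bounded[OF cc(2) zz(2)] by blast
  obtain M2 where M2: "M2 \<ge> 0" "\<And>x. \<bar>deriv (deriv \<phi>) x\<bar> \<le> M2"
    using continuous_compact_support_bounded[OF cc(3) zz(3)] by blast
  \<comment> \<open>The absolute value keeps \<open>S\<close> and \<open>m\<close> meaningful when
    \<open>R\<close> is negative.\<close>
  define S where "S = s \<bar>R\<bar>"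
  define m where "m = min 1 (s (- \<bar>R\<bar>))"
  have S: "S > 0" "\<And>x. \<bar>x\<bar> \<le> R \<Longrightarrow> s x \<le> S"
    using s_pos s_mono by (auto simp: S_def strict_mono_less_eq)
  have m: "m > 0" "m \<le> 1" "\<And>x. \<bar>x\<bar> \<le> R \<Longrightarrow> m \<le> s x"
    using s_pos s_mono by (auto simp: m_def strict_mono_less_eq min.coboundedI2)
  \<comment> \<open>The three summands serve Taylor's bound below the threshold, the crude bound
    below the threshold, and the bound above it, where \<open>z\<^sup>2\<close> is at least
    \<open>m\<^sup>2\<close>.\<close>
  define D where "D = M2 + (2 * M0 + M1 * S) + 2 * M0 / m\<^sup>2"
  have D: "D \<ge> 0" using M0 M1 M2 S m by (simp add: D_def)
  show thesis
  proof (rule that[OF D])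
    fix x z :: real assume x: "\<bar>x\<bar> \<le> R"
    let ?E = "compensated_increment \<phi> s x z"
    have tri: "\<bar>\<phi> (x + z) - \<phi> x\<bar> \<le> 2 * M0" using M0(2)[of "x + z"] M0(2)[of x] by linarith
    show "\<bar>?E\<bar> \<le> D * min 1 (z\<^sup>2)"
    proof (cases "\<bar>z\<bar> < s x")
      case True
      have "\<bar>?E\<bar> \<le> M2 * z\<^sup>2"
        using taylor_bound_second_order[OF D1 D2 M2(2), of x z] True by (simp add: compensated_increment_def)
      also have "\<dots> \<le> D * z\<^sup>2"
        using M0 M1 S m by (intro mult_right_mono) (auto simp: D_def)
      finally have 1: "\<bar>?E\<bar> \<le> D * z\<^sup>2" .
      have "\<bar>deriv \<phi> x * z\<bar> \<le> M1 * S"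
        unfolding abs_mult using M1 True S(2)[OF x] by (intro mult_mono) auto
      then have "\<bar>?E\<bar> \<le> 2 * M0 + M1 * S" using tri True by (simp add: compensated_increment_def)
      also have "\<dots> \<le> D" using M0 M2 m by (simp add: D_def)
      finally show ?thesis using 1 by (simp add: min_def)
    next
      case False
      then have "m \<le> \<bar>z\<bar>" using m(3)[OF x] by linarith
      then have "m\<^sup>2 \<le> z\<^sup>2" using m(1) by (metis abs_le_square_iff abs_of_pos)
      then have mz: "m\<^sup>2 \<le> min 1 (z\<^sup>2)" using m by (simp add: power_le_one)
      have "\<bar>?E\<bar> \<le> 2 * M0" using tri False by (simp add: compensated_increment_def)
      also have "\<dots> = 2 * M0 / m\<^sup>2 * m\<^sup>2" using m by simp
      also have "\<dots> \<le> D * min 1 (z\<^sup>2)"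
        using mz D M0 M1 M2 S by (intro mult_mono) (auto simp: D_def)
      finally show ?thesis .
    qed
  qed
qed

text \<open>For \<open>|x| > 2 * R\<close> the increment is just \<open>\<phi> (x + z)\<close>,
  which lives where \<open>|z| \<ge> |x| / 2\<close>; there the kernel is at most a constant times
  \<open>|x| powr (-1 - \<alpha>)\<close>. The factor \<open>s x powr \<alpha>\<close> grows at most
  like \<open>|x| powr \<alpha>\<close>, which leaves decay of order \<open>1 / |x|\<close>. The
  bound is for the integral of the absolute value because Fubini's theorem will need that.\<close>

lemma increment_bound:
  assumes \<phi>: "\<phi> \<in> C2c"
  obtains D where "\<And>x. integrable lborel (\<lambda>z. compensated_increment \<phi> s x z * k z)"
    and "\<And>x. s x powr \<alpha> * (LINT z|lborel. \<bar>compensated_increment \<phi> s x z\<bar> * k z) \<le> D / (1 + \<bar>x\<bar>)"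
proof -
  from \<phi> obtain R0 where "R0 > 0" and c\<phi>: "continuous_on UNIV \<phi>" and
    zz: "\<And>x. R0 \<le> \<bar>x\<bar> \<Longrightarrow> \<phi> x = 0" "\<And>x. R0 \<le> \<bar>x\<bar> \<Longrightarrow> deriv \<phi> x = 0"
    by (rule C2cE) blast
  define R where "R = max 1 R0"
  have R: "R \<ge> 1" "R \<ge> R0" by (auto simp: R_def)
  note C2c_measurable[OF \<phi>, measurable]
  have [measurable]: "(\<lambda>z. compensated_increment \<phi> s x z) \<in> borel_measurable borel" for x
    unfolding compensated_increment_def indicator_def mem_Collect_eq by measurable
  obtain D1 where D1: "D1 \<ge> 0"
    "\<And>x z. \<bar>x\<bar> \<le> 2 * R \<Longrightarrow> \<bar>compensated_increment \<phi> s x z\<bar> \<le> D1 * min 1 (z\<^sup>2)"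
    using increment_bound_near[OF \<phi>, of "2 * R"] by blast
  have km: "integrable lborel (\<lambda>z. D1 * (min 1 (z\<^sup>2) * k z))"
    by (intro integrable_mult_right integrable_min_1_square_stable_kernel \<alpha> b)
  have near: "\<bar>compensated_increment \<phi> s x z\<bar> * k z \<le> D1 * (min 1 (z\<^sup>2) * k z)" if "\<bar>x\<bar> \<le> 2 * R" for x z
    using mult_right_mono[OF D1(2)[OF that, of z] k_nonneg[of z]] by (simp add: mult_ac)
  obtain A where A: "\<And>x. s x \<le> A * (1 + \<bar>x\<bar>)" using s_growth by blast
  have "A > 0" using A[of 0] s_pos[of 0] by simp
  define C where "C = C_stable \<alpha>"
  have C: "C > 0" using C_stable_pos[OF \<alpha>] by (simp add: C_def)
  have i\<phi>: "integrable lborel (\<lambda>z. \<bar>\<phi> z\<bar>)"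
    using continuous_compact_support_integrable[OF c\<phi> zz(1)] by auto
  define I where "I = (LINT z|lborel. \<bar>\<phi> z\<bar>)"
  have I: "I \<ge> 0" by (simp add: I_def)
  have i\<phi>': "integrable lborel (\<lambda>z. \<bar>\<phi> (x + z)\<bar>)" and I': "(LINT z|lborel. \<bar>\<phi> (x + z)\<bar>) = I" for x
    using lborel_integrable_real_affine[OF i\<phi>, of 1 x] lborel_integral_real_affine[of 1 "\<lambda>z. \<bar>\<phi> z\<bar>" x]
    by (simp_all add: I_def)
  define c where "c x = C / (\<bar>x\<bar> / 2) powr (1 + \<alpha>)" for x :: real
  have far: "\<bar>compensated_increment \<phi> s x z\<bar> * k z \<le> c x * \<bar>\<phi> (x + z)\<bar>" if x: "\<not> \<bar>x\<bar> \<le> 2 * R" for x z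
  proof -
    have E: "compensated_increment \<phi> s x z = \<phi> (x + z)"
      using x R zz(1)[of x] zz(2)[of x] by (simp add: compensated_increment_def)
    show ?thesis
    proof (cases "R0 \<le> \<bar>x + z\<bar>")
      case True
      then show ?thesis using E zz(1) by simp
    next
      case False
      then have z: "\<bar>x\<bar> / 2 \<le> \<bar>z\<bar>" using x R by linarith
      have "k z \<le> C / \<bar>z\<bar> powr (1 + \<alpha>)"
        unfolding C_def by (rule stable_kernel_le[OF \<alpha> b])
      also have "\<dots> \<le> c x"
        unfolding c_def using z x R \<alpha> C
        by (intro divide_left_mono powr_mono2 mult_pos_pos) auto
      finally show ?thesis
        unfolding E by (subst mult.commute) (auto intro: mult_right_mono)
    qed
  qed
  have int: "integrable lborel (\<lambda>z. \<bar>compensated_increment \<phi> s x z\<bar> * k z)" for x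
  proof (cases "\<bar>x\<bar> \<le> 2 * R")
    case True
    show ?thesis
    proof (rule Bochner_Integration.integrable_bound[OF km])
      show "AE z in lborel. norm (\<bar>compensated_increment \<phi> s x z\<bar> * k z) \<le> norm (D1 * (min 1 (z\<^sup>2) * k z))"
        using near[OF True] k_nonneg D1 by (simp add: abs_mult)
    qed measurable
  next
    case False
    show ?thesis
    proof (rule Bochner_Integration.integrable_bound)
      show "integrable lborel (\<lambda>z. c x * \<bar>\<phi> (x + z)\<bar>)" by (intro integrable_mult_right i\<phi>')
      have "c x \<ge> 0" using C by (simp add: c_def)
      then show "AE z in lborel. norm (\<bar>compensated_increment \<phi> s x z\<bar> * k z) \<le> norm (c x * \<bar>\<phi> (x + z)\<bar>)"
        using far[OF False] k_nonneg by (simp add: abs_mult)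
    qed measurable
  qed
  define J where "J = (LINT z|lborel. D1 * (min 1 (z\<^sup>2) * k z))"
  have J: "J \<ge> 0" unfolding J_def using k_nonneg D1 by (intro integral_nonneg_AE) simp
  \<comment> \<open>The factor \<open>1 + 2 * R\<close> turns the constant bound near the origin
    into one of the form \<open>D / (1 + |x|)\<close>; the final factor 2 in \<open>Df\<close>
    absorbs \<open>1 + |x| \<le> 2 * |x|\<close>, valid far out.\<close>
  define Dn where "Dn = s (2 * R) powr \<alpha> * J * (1 + 2 * R)"
  define Df where "Df = (2 * A) powr \<alpha> * 2 powr (1 + \<alpha>) * C * I * 2"
  have Dn: "Dn \<ge> 0" using J R by (simp add: Dn_def)
  have Df: "Df \<ge> 0" using I C by (simp add: Df_def)
  show thesis
  proof (rule that[of "Dn + Df"])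
    show "integrable lborel (\<lambda>z. compensated_increment \<phi> s x z * k z)" for x
      by (rule Bochner_Integration.integrable_bound[OF int[of x]]) (auto simp: abs_mult)
    fix x
    let ?L = "LINT z|lborel. \<bar>compensated_increment \<phi> s x z\<bar> * k z"
    show "s x powr \<alpha> * ?L \<le> (Dn + Df) / (1 + \<bar>x\<bar>)"
    proof (cases "\<bar>x\<bar> \<le> 2 * R")
      case True
      have "?L \<le> J" unfolding J_def by (rule integral_mono[OF int km near[OF True]])
      moreover have "s x powr \<alpha> \<le> s (2 * R) powr \<alpha>"
        using s_pos[of x] s_mono True \<alpha> by (intro powr_mono2) (auto simp: strict_mono_less_eq)
      ultimately have "s x powr \<alpha> * ?L \<le> s (2 * R) powr \<alpha> * J"
        by (intro mult_mono) (auto intro!: integral_nonneg_AE simp: k_nonneg)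
      also have "\<dots> = Dn / (1 + 2 * R)" using R by (simp add: Dn_def)
      also have "\<dots> \<le> (Dn + Df) / (1 + \<bar>x\<bar>)"
        using True Dn Df by (intro frac_le) auto
      finally show ?thesis .
    next
      case False
      then have x: "\<bar>x\<bar> > 1" using R by linarith
      have "?L \<le> (LINT z|lborel. c x * \<bar>\<phi> (x + z)\<bar>)"
        by (rule integral_mono[OF int _ far[OF False]]) (intro integrable_mult_right i\<phi>')
      also have "\<dots> = c x * I" by (simp add: I')
      finally have 1: "?L \<le> c x * I" .
      have "s x \<le> 2 * A * \<bar>x\<bar>"
        using A[of x] mult_left_mono[of 1 "\<bar>x\<bar>" A] x \<open>A > 0\<close>
        unfolding distrib_left by linarith
      then have 2: "s x powr \<alpha> \<le> (2 * A * \<bar>x\<bar>) powr \<alpha>"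
        using s_pos[of x] \<alpha> by (intro powr_mono2) auto
      have "s x powr \<alpha> * ?L \<le> (2 * A * \<bar>x\<bar>) powr \<alpha> * (c x * I)"
        using 1 2 by (intro mult_mono) (auto intro!: integral_nonneg_AE simp: k_nonneg)
      also have "\<dots> = (2 * A) powr \<alpha> * 2 powr (1 + \<alpha>) * C * I / \<bar>x\<bar>"
        using x \<open>A > 0\<close> by (simp add: c_def powr_mult powr_divide powr_add field_simps)
      also have "\<dots> = Df / (2 * \<bar>x\<bar>)" by (simp add: Df_def)
      also have "\<dots> \<le> (Dn + Df) / (1 + \<bar>x\<bar>)"
        using x Dn Df by (intro frac_le) auto
      finally show ?thesis .
    qed
  qed
qed

definition nonlocal :: "(real \<Rightarrow> real) \<Rightarrow> real \<Rightarrow> real" where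
  "nonlocal \<phi> x = s x powr \<alpha> * (LINT z|lborel. compensated_increment \<phi> s x z * k z)"

lemma nonlocal_measurable:
  assumes "\<phi> \<in> C2c"
  shows "nonlocal \<phi> \<in> borel_measurable borel"
proof -
  note C2c_measurable(3)[OF assms, measurable]
  have "(\<lambda>x. LINT z|lborel. (\<lambda>(x, z). compensated_increment \<phi> s x z * k z) (x, z))
      \<in> borel_measurable borel"
    by (rule lborel.borel_measurable_lebesgue_integral) measurable
  then show ?thesis unfolding nonlocal_def[abs_def] by simp
qed

lemma nonlocal_L2:
  assumes "\<phi> \<in> C2c"
  shows "nonlocal \<phi> \<in> L2"
proof -
  obtain D where
    D: "\<And>x. s x powr \<alpha> * (LINT z|lborel. \<bar>compensated_increment \<phi> s x z\<bar> * k z) \<le> D / (1 + \<bar>x\<bar>)"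
    using increment_bound[OF assms] by blast
  show ?thesis
  proof (rule L2_bounded[OF inverse_1_plus_abs_L2[of D]])
    show "nonlocal \<phi> \<in> borel_measurable lebesgue"
      using nonlocal_measurable[OF assms] by (intro measurable_completion) simp
    fix x
    have "\<bar>LINT z|lborel. compensated_increment \<phi> s x z * k z\<bar>
        \<le> (LINT z|lborel. \<bar>compensated_increment \<phi> s x z\<bar> * k z)"
      using integral_abs_bound[of lborel "\<lambda>z. compensated_increment \<phi> s x z * k z"]
      by (simp add: abs_mult k_nonneg)
    then show "\<bar>nonlocal \<phi> x\<bar> \<le> D / (1 + \<bar>x\<bar>)"
      using order_trans[OF mult_left_mono D[of x]] unfolding nonlocal_def abs_mult by simp
  qed
qed

text \<open>The inner absolute integral is at most \<open>|v x| * D / (1 + |x|)\<close>, a product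
  of two square-integrable functions.\<close>

lemma nonlocal_pair_integrable:
  assumes \<phi>: "\<phi> \<in> C2c" and v: "v \<in> L2" and [measurable]: "v \<in> borel_measurable borel"
  shows "integrable (lborel \<Otimes>\<^sub>M lborel)
    (\<lambda>(x, z). s x powr \<alpha> * v x * compensated_increment \<phi> s x z * k z)"
proof -
  note C2c_measurable(3)[OF \<phi>, measurable]
  obtain D where
    int: "\<And>x. integrable lborel (\<lambda>z. compensated_increment \<phi> s x z * k z)" and
    D: "\<And>x. s x powr \<alpha> * (LINT z|lborel. \<bar>compensated_increment \<phi> s x z\<bar> * k z) \<le> D / (1 + \<bar>x\<bar>)"
    using increment_bound[OF \<phi>] by blast
  let ?F = "\<lambda>(x, z). s x powr \<alpha> * v x * compensated_increment \<phi> s x z * k z"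
  let ?L = "\<lambda>x. LINT z|lborel. \<bar>compensated_increment \<phi> s x z\<bar> * k z"
  have [measurable]: "?L \<in> borel_measurable borel"
  proof -
    have "(\<lambda>x. LINT z|lborel. (\<lambda>(x, z). \<bar>compensated_increment \<phi> s x z\<bar> * k z) (x, z))
      \<in> borel_measurable borel"
      by (rule lborel.borel_measurable_lebesgue_integral) measurable
    then show ?thesis by simp
  qed
  show ?thesis
  proof (rule lborel_pair.Fubini_integrable)
    show "?F \<in> borel_measurable (lborel \<Otimes>\<^sub>M lborel)" by measurable
    have eq: "(LINT z|lborel. norm (?F (x, z))) = \<bar>v x\<bar> * (s x powr \<alpha> * ?L x)" for x
    proof -
      have "(LINT z|lborel. norm (?F (x, z)))
          = (LINT z|lborel. (\<bar>v x\<bar> * s x powr \<alpha>) * (\<bar>compensated_increment \<phi> s x z\<bar> * k z))"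
        by (intro Bochner_Integration.integral_cong) (auto simp: abs_mult k_nonneg)
      then show ?thesis by simp
    qed
    have "(\<lambda>x. \<bar>v x\<bar>) \<in> L2" using v by (auto simp: L2_def)
    from L2_integrable_mult[OF this inverse_1_plus_abs_L2[of D]]
    have "integrable lborel (\<lambda>x. \<bar>v x\<bar> * (D / (1 + \<bar>x\<bar>)))"
      by (subst (asm) integrable_completion) auto
    then have "integrable lborel (\<lambda>x. \<bar>v x\<bar> * (s x powr \<alpha> * ?L x))"
    proof (rule Bochner_Integration.integrable_bound)
      have "norm (\<bar>v x\<bar> * (s x powr \<alpha> * ?L x)) \<le> norm (\<bar>v x\<bar> * (D / (1 + \<bar>x\<bar>)))" for x
      proof -
        have "0 \<le> s x powr \<alpha> * ?L x"
          by (intro mult_nonneg_nonneg integral_nonneg_AE) (auto simp: k_nonneg)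
        then have "\<bar>s x powr \<alpha> * ?L x\<bar> \<le> \<bar>D / (1 + \<bar>x\<bar>)\<bar>" using D[of x] by linarith
        then show ?thesis unfolding real_norm_def abs_mult[of "\<bar>v x\<bar>"] by (rule mult_left_mono) simp
      qed
      then show "AE x in lborel. norm (\<bar>v x\<bar> * (s x powr \<alpha> * ?L x)) \<le> norm (\<bar>v x\<bar> * (D / (1 + \<bar>x\<bar>)))"
        by simp
    qed measurable
    then show "integrable lborel (\<lambda>x. LINT z|lborel. norm (?F (x, z)))" unfolding eq .
    show "AE x in lborel. integrable lborel (\<lambda>z. ?F (x, z))"
      using integrable_mult_right[OF int] by (simp add: mult.assoc)
  qed
qed

end

section \<open>The adjoint of the nonlocal operator\<close>

text \<open>Needed because the adjoint reverses jumps: a jump \<open>z\<close> of the test function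
  is matched with a jump \<open>-z\<close> of the other factor.\<close>

lemma integrable_reflect_snd:
  fixes F :: "real \<times> real \<Rightarrow> real"
  assumes F: "integrable (lborel \<Otimes>\<^sub>M lborel) F"
  shows "integrable (lborel \<Otimes>\<^sub>M lborel) (\<lambda>(x, z). F (x, - z))"
proof (rule lborel_pair.Fubini_integrable)
  have [measurable]: "F \<in> borel_measurable (borel \<Otimes>\<^sub>M borel)"
    using borel_measurable_integrable[OF F] by simp
  show "(\<lambda>(x, z). F (x, - z)) \<in> borel_measurable (lborel \<Otimes>\<^sub>M lborel)" by measurable
  have "(LINT z|lborel. norm (F (x, - z))) = (LINT z|lborel. norm (F (x, z)))" for x
    using lborel_integral_real_affine[of "-1" "\<lambda>z. norm (F (x, z))" 0] by simp
  then show "integrable lborel (\<lambda>x. LINT z|lborel. norm (case (x, z) of (x, z) \<Rightarrow> F (x, - z)))"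
    using lborel_pair.integrable_fst'[OF integrable_norm[OF F]] by simp
  have "AE x in lborel. integrable lborel (\<lambda>z. F (x, z))"
    by (rule lborel_pair.AE_integrable_fst'[OF F])
  then show "AE x in lborel. integrable lborel (\<lambda>z. case (x, z) of (x, z) \<Rightarrow> F (x, - z))"
  proof eventually_elim
    case (elim x)
    then show ?case using lborel_integrable_real_affine[of "\<lambda>z. F (x, z)" "-1" 0] by simp
  qed
qed

context jump_coefficient
begin

lemma s'_nonneg: "s' x \<ge> 0"
proof (rule ccontr)
  assume "\<not> s' x \<ge> 0"
  then obtain d where "d > 0" "\<And>h. 0 < h \<Longrightarrow> h < d \<Longrightarrow> s x > s (x + h)"
    using DERIV_neg_dec_right[OF s_deriv[of x]] by auto
  from this(2)[of "d / 2"] \<open>d > 0\<close> have "s x > s (x + d / 2)" by simp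
  moreover have "s x < s (x + d / 2)"
    using s_mono \<open>d > 0\<close> by (simp add: strict_mono_less)
  ultimately show False by simp
qed

text \<open>A single small jump suffices: for \<open>x\<close> in \<open>{-n..n}\<close> the jump
  \<open>z0\<close> lies below \<open>s (-n) \<le> s x\<close>, so the compensator is active and
  \<open>deriv u x\<close> can be solved for in terms of \<open>u\<close> and the increment. This
  yields Borel measurability even at points where \<open>u\<close> is not differentiable and
  \<open>deriv\<close> returns an unspecified value.\<close>

lemma deriv_measurable_of_increment:
  assumes cu: "continuous_on UNIV u"
    and M: "\<And>a c. (\<lambda>(x, z). indicator {a..c} x * indicator (-{0}) z * compensated_increment u s x z)
        \<in> borel_measurable (borel \<Otimes>\<^sub>M borel)"
  shows "deriv u \<in> borel_measurable borel"
proof (rule borel_measurable_LIMSEQ_real)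
  have [measurable]: "u \<in> borel_measurable borel" using cu by (rule borel_measurable_continuous_onI)
  fix n :: nat
  define z0 where "z0 = s (- real n) / 2"
  have z0: "z0 > 0" using s_pos by (simp add: z0_def)
  let ?g = "\<lambda>x. indicator {- real n..real n} x * compensated_increment u s x z0"
  have "(\<lambda>x. (\<lambda>(x, z). indicator {- real n..real n} x * indicator (-{0}) z *
      compensated_increment u s x z) (x, z0)) \<in> borel_measurable borel"
    using M[of "- real n" "real n"] by measurable
  then have [measurable]: "?g \<in> borel_measurable borel" using z0 by simp
  have "indicator {- real n..real n} x * deriv u x
      = (indicator {- real n..real n} x * (u (x + z0) - u x) - ?g x) / z0" for x
  proof (cases "x \<in> {- real n..real n}")
    case True
    have "s (- real n) \<le> s x" using s_mono True by (simp add: strict_mono_less_eq)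
    then have "z0 < s x" using s_pos[of "- real n"] by (simp add: z0_def)
    with True z0 show ?thesis by (simp add: compensated_increment_def)
  qed simp
  then show "(\<lambda>x. indicator {- real n..real n} x * deriv u x) \<in> borel_measurable borel"
    by simp
next
  fix x
  obtain N :: nat where "\<bar>x\<bar> \<le> real N" using real_arch_simple by blast
  then have "\<forall>\<^sub>F n in sequentially. indicator {- real n..real n} x * deriv u x = deriv u x"
    by (intro eventually_sequentiallyI[of N]) (auto simp: indicator_def)
  then show "(\<lambda>n. indicator {- real n..real n} x * deriv u x) \<longlonglongrightarrow> deriv u x"
    by (rule tendsto_eventually)
qed

text \<open>For a fixed jump size \<open>z\<close> the two sides differ only by \<open>z\<close> times the integral of
  \<open>(u \<phi>)'\<close> over \<open>{x. \<bar>z\<bar> < s x}\<close>. Since \<open>s\<close> is increasing this set is a half line, which leaves the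
  boundary value \<open>u \<phi>\<close> at \<open>s\<^sup>-\<^sup>1 \<bar>z\<bar>\<close>; integrating it over \<open>z\<close> gives the correction term.\<close>

lemma nonlocal_adjoint:
  fixes v :: "real \<Rightarrow> real"
  defines "u \<equiv> \<lambda>x. s x powr \<alpha> * v x"
  assumes \<phi>: "\<phi> \<in> C2c" and v: "v \<in> L2" and ac: "locally_ac u"
    and M: "\<And>a c. (\<lambda>(x, z). indicator {a..c} x * indicator (-{0}) z * compensated_increment u s x z)
        \<in> borel_measurable (borel \<Otimes>\<^sub>M borel)"
    and Q: "\<And>a c. integrable (lborel \<Otimes>\<^sub>M lborel)
        (\<lambda>(x, z). indicator {a..c} x * compensated_increment u s x z * stable_kernel \<alpha> (- b) z)"
  shows "(LINT x|lborel. nonlocal \<phi> x * v x)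
    = (LINT x|lborel. \<phi> x * (LINT z|lborel. compensated_increment u s x z * stable_kernel \<alpha> (- b) z))
      + b * C_stable \<alpha> * (LINT x|lborel. \<phi> x * (v x * s' x))"
proof -
  let ?kk = "stable_kernel \<alpha> (- b)"
  from \<phi> obtain R where R: "R > 0" and
    D1: "\<And>x. (\<phi> has_real_derivative deriv \<phi> x) (at x)" and
    c\<phi>: "continuous_on UNIV \<phi>" and c\<phi>': "continuous_on UNIV (deriv \<phi>)" and
    z\<phi>: "\<And>x. R \<le> \<bar>x\<bar> \<Longrightarrow> \<phi> x = 0" and z\<phi>': "\<And>x. R \<le> \<bar>x\<bar> \<Longrightarrow> deriv \<phi> x = 0"
    by (rule C2cE) blast
  have cu: "continuous_on UNIV u" by (rule locally_ac_continuous[OF ac])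
  have s0: "s x \<noteq> 0" for x using s_pos[of x] by simp
  \<comment> \<open>Membership in \<open>L2\<close> yields Lebesgue measurability; Borel
    measurability of \<open>v\<close> comes from the continuity of \<open>u\<close> and the
    positivity of \<open>s\<close>.\<close>
  have v_eq: "v = (\<lambda>x. u x / s x powr \<alpha>)" by (simp add: u_def s0 fun_eq_iff)
  have "continuous_on UNIV v"
    unfolding v_eq by (intro continuous_intros cu s_cont) (auto simp: s0)
  then have [measurable]: "v \<in> borel_measurable borel" by (rule borel_measurable_continuous_onI)
  note C2c_measurable[OF \<phi>, measurable]
  have [measurable]: "u \<in> borel_measurable borel" using cu by (rule borel_measurable_continuous_onI)
  have du[measurable]: "deriv u \<in> borel_measurable borel"
    by (rule deriv_measurable_of_increment[OF cu M])
  have [measurable]: "(\<lambda>(x, z). compensated_increment u s x z) \<in> borel_measurable (borel \<Otimes>\<^sub>M borel)"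
    by (rule compensated_increment_measurable) measurable
  have cu_shift: "continuous_on UNIV (\<lambda>x. u (x + z))" for z
    by (intro continuous_on_compose2[OF cu] continuous_intros) auto
  define H where "H r = (LINT x|lborel. (\<phi> x * deriv u x + deriv \<phi> x * u x) * indicator {x. r < s x} x)"
    for r

  have iP: "integrable (lborel \<Otimes>\<^sub>M lborel) (\<lambda>(x, z). u x * compensated_increment \<phi> s x z * k z)"
    unfolding u_def by (rule nonlocal_pair_integrable[OF \<phi> v]) measurable
  obtain C where C: "C \<ge> 0" "\<And>x. \<bar>\<phi> x\<bar> \<le> C"
    using continuous_compact_support_bounded[OF c\<phi> z\<phi>] by blast
  have iN0: "integrable (lborel \<Otimes>\<^sub>M lborel) (\<lambda>(x, z). \<phi> x * compensated_increment u s x z * ?kk z)"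
  proof (rule Bochner_Integration.integrable_bound[OF integrable_mult_right[OF Q[of "-R" R], of C]])
    have "\<bar>\<phi> x * compensated_increment u s x z * ?kk z\<bar>
        \<le> \<bar>C * (indicator {-R..R} x * compensated_increment u s x z * ?kk z)\<bar>" for x z
    proof (cases "R \<le> \<bar>x\<bar>")
      case False
      then have "x \<in> {-R..R}" by auto
      then show ?thesis using C mult_right_mono[OF C(2)[of x], of "\<bar>compensated_increment u s x z * ?kk z\<bar>"]
        by (simp add: abs_mult mult.assoc)
    qed (simp add: z\<phi>)
    then show "AE p in lborel \<Otimes>\<^sub>M lborel. norm (case p of (x, z) \<Rightarrow> \<phi> x * compensated_increment u s x z * ?kk z)
      \<le> norm (C * (case p of (x, z) \<Rightarrow> indicator {-R..R} x * compensated_increment u s x z * ?kk z))"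
      by (auto simp: case_prod_unfold)
  qed measurable
  \<comment> \<open>Reflecting \<open>z\<close> turns the kernel with parameter \<open>-b\<close>
    into \<open>k\<close>, so that both sides carry the same weight and can be compared for each
    \<open>z\<close>.\<close>
  from integrable_reflect_snd[OF iN0]
  have iN: "integrable (lborel \<Otimes>\<^sub>M lborel) (\<lambda>(x, z). \<phi> x * compensated_increment u s x (- z) * k z)"
    by (simp add: stable_kernel_uminus)

  have cs: "integrable lborel (\<lambda>x. h x * \<phi> x)" "integrable lborel (\<lambda>x. h x * deriv \<phi> x)"
    if "continuous_on UNIV h" for h
    using that c\<phi> c\<phi>' z\<phi> z\<phi>'
    by (auto intro!: continuous_compact_support_integrable[where R = R] continuous_on_mult)
  have by_parts_int: "integrable lborel (\<lambda>x. \<phi> x * deriv u x)"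
  proof -
    have "integrable lebesgue (\<lambda>x. \<phi> x * deriv u x)"
      by (rule locally_ac_by_parts_compact_support(1)[OF ac R D1 c\<phi>']) (use z\<phi> z\<phi>' in auto)
    then show ?thesis by (subst (asm) integrable_completion) auto
  qed
  have ind: "integrable lborel (\<lambda>x. h x * indicator {x. r < s x} x)"
    if "integrable lborel h" for h :: "real \<Rightarrow> real" and r
    using integrable_mult_indicator[of "{x. r < s x}" lborel h] that by (simp add: mult.commute)
  have ints: "integrable lborel (\<lambda>x. \<phi> x * deriv u x * indicator {x. r < s x} x)"
    "integrable lborel (\<lambda>x. deriv \<phi> x * u x * indicator {x. r < s x} x)" for r
    using ind[OF by_parts_int] ind[OF cs(2)[OF cu]] by (simp_all add: mult.commute)
  have H_split: "H r = (LINT x|lborel. \<phi> x * deriv u x * indicator {x. r < s x} x)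
      + (LINT x|lborel. deriv \<phi> x * u x * indicator {x. r < s x} x)" for r
    unfolding H_def distrib_right by (rule Bochner_Integration.integral_add[OF ints])

  \<comment> \<open>Translation by \<open>z\<close> moves the shift from \<phi> to \<open>u\<close>,
    so the terms without derivatives cancel. The compensators remain, and they add up to the product
    rule because the jumps have opposite signs.\<close>
  have per_jump: "(LINT x|lborel. u x * compensated_increment \<phi> s x z)
     - (LINT x|lborel. \<phi> x * compensated_increment u s x (- z)) = - (z * H \<bar>z\<bar>)" for z
  proof -
    have i1: "integrable lborel (\<lambda>x. u (x - z) * \<phi> x)"
      using cs(1)[OF cu_shift[of "- z"]] by simp
    have i2: "integrable lborel (\<lambda>x. u x * \<phi> (x + z))"
      using lborel_integrable_real_affine[OF i1, of 1 z] by (simp add: add.commute)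
    have shift: "(LINT x|lborel. u x * \<phi> (x + z)) = (LINT x|lborel. u (x - z) * \<phi> x)"
      using lborel_integral_real_affine[of 1 "\<lambda>x. u (x - z) * \<phi> x" z] by (simp add: add.commute)
    note i3 = cs(1)[OF cu]
    have "(LINT x|lborel. u x * compensated_increment \<phi> s x z)
      = (LINT x|lborel. u x * \<phi> (x + z) - u x * \<phi> x
          - z * (deriv \<phi> x * u x * indicator {x. \<bar>z\<bar> < s x} x))"
      by (intro Bochner_Integration.integral_cong)
        (auto simp: compensated_increment_def algebra_simps indicator_def)
    also have "\<dots> = (LINT x|lborel. u (x - z) * \<phi> x) - (LINT x|lborel. u x * \<phi> x)
        - z * (LINT x|lborel. deriv \<phi> x * u x * indicator {x. \<bar>z\<bar> < s x} x)"
      using i2 i3 ints(2)[of "\<bar>z\<bar>"] shift by simp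
    finally have e1: "(LINT x|lborel. u x * compensated_increment \<phi> s x z) = \<dots>" .
    have "(LINT x|lborel. \<phi> x * compensated_increment u s x (- z))
      = (LINT x|lborel. u (x - z) * \<phi> x - u x * \<phi> x
          + z * (\<phi> x * deriv u x * indicator {x. \<bar>z\<bar> < s x} x))"
      by (intro Bochner_Integration.integral_cong)
        (auto simp: compensated_increment_def algebra_simps indicator_def)
    also have "\<dots> = (LINT x|lborel. u (x - z) * \<phi> x) - (LINT x|lborel. u x * \<phi> x)
        + z * (LINT x|lborel. \<phi> x * deriv u x * indicator {x. \<bar>z\<bar> < s x} x)"
      using i1 i3 ints(1)[of "\<bar>z\<bar>"] by simp
    finally show ?thesis unfolding e1 H_split by (simp add: algebra_simps)
  qed

  have H_s: "H (s c) = - (\<phi> c * u c)" for c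
  proof -
    \<comment> \<open>A point to the right of both \<open>c\<close> and the support; it replaces the
      half line by a compact interval, at whose right end the boundary term vanishes.\<close>
    define T where "T = max R c"
    have T: "c \<le> T" "R \<le> T" "R \<le> \<bar>T\<bar>" using R by (auto simp: T_def)
    let ?F = "\<lambda>x. \<phi> x * deriv u x + deriv \<phi> x * u x"
    have cl: "continuous_on UNIV (\<lambda>x. deriv \<phi> x * u x)" by (intro continuous_intros c\<phi>' cu)
    have iL: "set_integrable lebesgue {c..T} (\<lambda>x. deriv \<phi> x * u x)"
      by (intro absolutely_integrable_continuous_real continuous_on_subset[OF cl]) auto
    have "H (s c) = (LINT x|lborel. indicator {c..T} x * ?F x)"
      unfolding H_def
    proof (rule integral_cong_AE)
      show "AE x in lborel. ?F x * indicator {x. s c < s x} x = indicator {c..T} x * ?F x"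
        using AE_lborel_singleton[of c]
      proof eventually_elim
        case (elim x)
        show ?case
        proof (cases "R \<le> \<bar>x\<bar>")
          case False
          then have "x < T" using T by linarith
          then show ?thesis
            using elim s_mono by (auto simp: indicator_def strict_mono_less)
        qed (simp add: z\<phi> z\<phi>')
      qed
    qed measurable
    also have "\<dots> = (LINT x:{c..T}|lebesgue. ?F x)"
      unfolding set_lebesgue_integral_def by (subst integral_completion) auto
    also have "\<dots> = (LINT x:{c..T}|lebesgue. \<phi> x * deriv u x) + (LINT x:{c..T}|lebesgue. deriv \<phi> x * u x)"
      using locally_ac_by_parts(1)[OF ac T(1) D1 c\<phi>'] iL by (rule set_integral_add(2))
    also have "\<dots> = \<phi> T * u T - \<phi> c * u c"
      using locally_ac_by_parts(2)[OF ac T(1) D1 c\<phi>'] by simp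
    finally show ?thesis using z\<phi>[OF T(3)] by simp
  qed

  \<comment> \<open>The range of \<open>s\<close> on the support of \<phi>. \<open>H\<close>
    vanishes outside \<open>{l..m}\<close>, and \<open>l > 0\<close> keeps the singularity of the
    kernel at 0 away.\<close>
  define l where "l = s (- R)"
  define m where "m = s R"
  have lm: "0 < l" "l \<le> m" using s_pos s_mono R by (auto simp: l_def m_def strict_mono_less_eq)
  have ivt: "\<exists>c\<in>{-R..R}. r = s c" if "r \<in> {l..m}" for r
    using IVT'[of s "-R" r R] that R continuous_on_subset[OF s_cont] by (force simp: l_def m_def)
  have H_out: "H r = 0" if "r \<notin> {l..m}" for r
  proof (cases "r < l")
    case True
    have "H r = H (s (- R))"
      unfolding H_def
    proof (rule integral_cong_AE)
      show "AE x in lborel. (\<phi> x * deriv u x + deriv \<phi> x * u x) * indicator {x. r < s x} x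
          = (\<phi> x * deriv u x + deriv \<phi> x * u x) * indicator {x. s (- R) < s x} x"
      proof (rule AE_I2)
        fix x
        show "(\<phi> x * deriv u x + deriv \<phi> x * u x) * indicator {x. r < s x} x
          = (\<phi> x * deriv u x + deriv \<phi> x * u x) * indicator {x. s (- R) < s x} x"
        proof (cases "R \<le> \<bar>x\<bar>")
          case False
          then have "s (- R) < s x" using s_mono by (simp add: strict_mono_less)
          then show ?thesis using True by (simp add: l_def)
        qed (simp add: z\<phi> z\<phi>')
      qed
    qed measurable
    then show ?thesis using H_s[of "-R"] z\<phi>[of "-R"] R by simp
  next
    case False
    with that have r: "r > m" by auto
    have "H r = integral\<^sup>L lborel (\<lambda>x :: real. 0 :: real)"
      unfolding H_def
    proof (intro Bochner_Integration.integral_cong refl)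
      fix x
      show "(\<phi> x * deriv u x + deriv \<phi> x * u x) * indicator {x. r < s x} x = 0"
      proof (cases "r < s x")
        case True
        then have "s R < s x" using r by (simp add: m_def)
        then have "R < x" using s_mono by (simp add: strict_mono_less)
        then show ?thesis by (simp add: z\<phi> z\<phi>')
      qed simp
    qed
    then show ?thesis by simp
  qed

  \<comment> \<open>Inverting \<open>s\<close> on a compact interval makes the inverse
    continuous.\<close>
  define inv_s where "inv_s = the_inv_into {-R..R} s"
  have inj: "inj_on s {-R..R}" using s_mono by (meson inj_on_subset strict_mono_imp_inj_on subset_UNIV)
  have inv_s: "inv_s (s x) = x" if "x \<in> {-R..R}" for x
    using the_inv_into_f_f[OF inj that] by (simp add: inv_s_def)
  have img: "s ` {-R..R} = {l..m}"
  proof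
    show "s ` {-R..R} \<subseteq> {l..m}" using s_mono by (auto simp: l_def m_def strict_mono_less_eq)
    show "{l..m} \<subseteq> s ` {-R..R}" using ivt by blast
  qed
  have c_inv: "continuous_on {l..m} inv_s"
    using continuous_on_inv[of "{-R..R}" s inv_s] inv_s continuous_on_subset[OF s_cont] img by auto
  \<comment> \<open>This is \<open>- H r\<close> times the power of \<open>r\<close> left over from
    \<open>r / r powr (1 + \<alpha>)\<close>. At \<open>r = s x\<close> the power cancels the factor
    \<open>s x powr \<alpha>\<close> in \<open>u\<close>, so the substitution produces
    \<open>\<phi> x * v x * s' x\<close>.\<close>
  define G where "G r = \<phi> (inv_s r) * u (inv_s r) * r powr (- \<alpha>)" for r
  have HG: "- H r * r powr (- \<alpha>) = G r" if r: "r \<in> {l..m}" for r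
  proof -
    obtain c where "c \<in> {-R..R}" "r = s c" using ivt[OF r] by blast
    then show ?thesis by (simp add: H_s G_def inv_s)
  qed
  have cG: "continuous_on {l..m} G"
    unfolding G_def using lm
    by (intro continuous_intros continuous_on_compose2[OF c\<phi> c_inv] continuous_on_compose2[OF cu c_inv]) auto
  have iG: "set_integrable lborel {l..m} G" by (rule borel_integrable_atLeastAtMost'[OF cG])
  have subst: "(LINT r|lborel. G r * indicator {l..m} r) = (LINT x|lborel. \<phi> x * (v x * s' x))"
  proof -
    have "(LINT r|lborel. G r * indicator {s (-R)..s R} r)
        = (LINT x|lborel. G (s x) * s' x * indicator {-R..R} x)"
      by (rule integral_substitution(2))
        (use iG s_deriv s'_nonneg s'_cont R in \<open>auto simp: l_def m_def intro: continuous_on_subset\<close>)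
    also have "\<dots> = (LINT x|lborel. \<phi> x * (v x * s' x))"
    proof (rule Bochner_Integration.integral_cong)
      fix x
      show "G (s x) * s' x * indicator {-R..R} x = \<phi> x * (v x * s' x)"
      proof (cases "R \<le> \<bar>x\<bar>")
        case True
        then show ?thesis using inv_s[of x] z\<phi>[of x] by (auto simp: G_def indicator_def)
      next
        case False
        then have "x \<in> {-R..R}" by auto
        then show ?thesis using s0[of x] by (simp add: G_def inv_s u_def powr_minus)
      qed
    qed simp
    finally show ?thesis by (simp add: l_def m_def)
  qed
  define q where "q r = G r * indicator {l..m} r" for r
  have iq: "integrable lborel q" using iG by (simp add: set_integrable_def q_def[abs_def] mult.commute)
  have iq': "integrable lborel (\<lambda>z. q (- z))"
    using lborel_integrable_real_affine[OF iq, of "-1" 0] by simp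
  have qq: "(LINT z|lborel. q (- z)) = (LINT z|lborel. q z)"
    using lborel_integral_real_affine[of "-1" q 0] by simp
  \<comment> \<open>The factor \<open>z\<close> is odd while \<open>H\<close> depends on its
    absolute value, so the two half lines enter with opposite signs. Their integrals are equal,
    which leaves the factor \<open>C_pos \<alpha> b - C_neg \<alpha> b\<close>.\<close>
  have kz: "- (z * H \<bar>z\<bar>) * k z = C_pos \<alpha> b * q z - C_neg \<alpha> b * q (- z)" for z
  proof -
    have *: "- (r * H r) / r powr (1 + \<alpha>) = q r" if "r > 0" for r
    proof (cases "r \<in> {l..m}")
      case True
      have "- (r * H r) / r powr (1 + \<alpha>) = - H r * r powr (- \<alpha>)"
        using that by (simp add: powr_add powr_minus divide_simps)
      with HG[OF True] True show ?thesis by (simp add: q_def)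
    qed (simp add: q_def H_out)
    have q0: "q r = 0" if "r \<le> 0" for r using that lm by (simp add: q_def)
    show ?thesis
    proof (cases z "0 :: real" rule: linorder_cases)
      case less
      then have "- (z * H \<bar>z\<bar>) * k z = - (C_neg \<alpha> b * (z * H (- z) / (- z) powr (1 + \<alpha>)))"
        by (simp add: stable_kernel_def)
      also have "z * H (- z) / (- z) powr (1 + \<alpha>) = q (- z)" using *[of "- z"] less by simp
      finally show ?thesis using q0[of z] less by simp
    next
      case greater
      then have "- (z * H \<bar>z\<bar>) * k z = C_pos \<alpha> b * (- (z * H z) / z powr (1 + \<alpha>))"
        by (simp add: stable_kernel_def)
      also have "- (z * H z) / z powr (1 + \<alpha>) = q z" using *[of z] greater by simp
      finally show ?thesis using q0[of "- z"] greater by simp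
    qed (simp add: q0)
  qed

  have P: "(LINT x|lborel. nonlocal \<phi> x * v x)
      = (LINT z|lborel. (LINT x|lborel. u x * compensated_increment \<phi> s x z) * k z)"
  proof -
    have "(LINT x|lborel. nonlocal \<phi> x * v x)
      = (LINT x|lborel. LINT z|lborel. u x * compensated_increment \<phi> s x z * k z)"
      by (simp add: nonlocal_def u_def mult_ac flip: integral_mult_right_zero)
    also have "\<dots> = (LINT z|lborel. LINT x|lborel. u x * compensated_increment \<phi> s x z * k z)"
      using lborel_pair.Fubini_integral[OF iP] by simp
    finally show ?thesis by simp
  qed
  have N: "(LINT x|lborel. \<phi> x * (LINT z|lborel. compensated_increment u s x z * ?kk z))
      = (LINT z|lborel. (LINT x|lborel. \<phi> x * compensated_increment u s x (- z)) * k z)"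
  proof -
    have "(LINT z|lborel. compensated_increment u s x z * ?kk z)
        = (LINT z|lborel. compensated_increment u s x (- z) * k z)" for x
      using lborel_integral_real_affine[of "-1" "\<lambda>z. compensated_increment u s x z * ?kk z" 0]
      by (simp add: stable_kernel_uminus)
    then have "(LINT x|lborel. \<phi> x * (LINT z|lborel. compensated_increment u s x z * ?kk z))
      = (LINT x|lborel. LINT z|lborel. \<phi> x * compensated_increment u s x (- z) * k z)"
      by (simp add: mult.assoc)
    also have "\<dots> = (LINT z|lborel. LINT x|lborel. \<phi> x * compensated_increment u s x (- z) * k z)"
      using lborel_pair.Fubini_integral[OF iN] by simp
    finally show ?thesis by simp
  qed
  have "(LINT x|lborel. nonlocal \<phi> x * v x)
      - (LINT x|lborel. \<phi> x * (LINT z|lborel. compensated_increment u s x z * ?kk z))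
      = (LINT z|lborel. (LINT x|lborel. u x * compensated_increment \<phi> s x z) * k z
          - (LINT x|lborel. \<phi> x * compensated_increment u s x (- z)) * k z)"
    unfolding P N
    using lborel_pair.integrable_snd[OF iP] lborel_pair.integrable_snd[OF iN]
    by (intro Bochner_Integration.integral_diff[symmetric]) simp_all
  also have "\<dots> = (LINT z|lborel. C_pos \<alpha> b * q z - C_neg \<alpha> b * q (- z))"
    unfolding left_diff_distrib[symmetric] per_jump kz ..
  also have "\<dots> = (C_pos \<alpha> b - C_neg \<alpha> b) * (LINT z|lborel. q z)"
    using iq iq' by (simp add: qq left_diff_distrib)
  also have "C_pos \<alpha> b - C_neg \<alpha> b = b * C_stable \<alpha>"
    by (simp add: C_pos_def C_neg_def field_simps)
  also have "(LINT z|lborel. q z) = (LINT x|lborel. \<phi> x * (v x * s' x))"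
    unfolding q_def by (rule subst)
  finally show ?thesis by simp
qed

end

section \<open>The adjoint of the generator\<close>

lemma C2c_mult_integrable:
  assumes \<phi>: "\<phi> \<in> C2c" and r: "\<And>a c. set_integrable lebesgue {a..c} r"
  shows "integrable lebesgue (\<lambda>x. \<phi> x * r x)"
proof -
  from \<phi> obtain R where c\<phi>: "continuous_on UNIV \<phi>" and z\<phi>: "\<And>x. R \<le> \<bar>x\<bar> \<Longrightarrow> \<phi> x = 0"
    by (rule C2cE) blast
  obtain C where C: "C \<ge> 0" "\<And>x. \<bar>\<phi> x\<bar> \<le> C"
    using continuous_compact_support_bounded[OF c\<phi> z\<phi>] by blast
  have i: "integrable lebesgue (\<lambda>x. indicator {-R..R} x * r x)"
    using r[of "-R" R] by (simp add: set_integrable_def)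
  have eq: "\<phi> x * r x = \<phi> x * (indicator {-R..R} x * r x)" for x
    by (cases "R \<le> \<bar>x\<bar>") (auto simp: z\<phi> indicator_def)
  have [measurable]: "\<phi> \<in> borel_measurable lebesgue"
    using c\<phi> by (intro measurable_completion) (simp add: borel_measurable_continuous_onI)
  show ?thesis unfolding eq
  proof (rule Bochner_Integration.integrable_bound[OF integrable_mult_right[OF i, of C]])
    show "(\<lambda>x. \<phi> x * (indicator {-R..R} x * r x)) \<in> borel_measurable lebesgue"
      using borel_measurable_integrable[OF i] by (rule borel_measurable_times[rotated]) measurable
    show "AE x in lebesgue. norm (\<phi> x * (indicator {-R..R} x * r x)) \<le> norm (C * (indicator {-R..R} x * r x))"
      using C unfolding real_norm_def abs_mult[of C] abs_mult[of "\<phi> _"]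
      by (auto intro!: mult_right_mono)
  qed
qed

lemma L2_set_integrable:
  assumes "w \<in> L2"
  shows "set_integrable lebesgue {a..c::real} w"
proof -
  have "integrable lborel (\<lambda>x. (indicator {a..c} x :: real)\<^sup>2)"
    using borel_integrable_atLeastAtMost'[of a c "\<lambda>_. 1 :: real"]
    by (simp add: set_integrable_def power2_eq_square flip: indicator_inter_arith)
  then have "indicator {a..c} \<in> L2"
    by (auto simp: L2_def integrable_completion intro!: measurable_completion)
  from L2_integrable_mult[OF this assms] show ?thesis by (simp add: set_integrable_def)
qed

text \<open>Both sign cases in one interface: \<open>b\<close> is the skewness after the
  substitution and \<open>s'\<close> the derivative of the absolute value of \<sigma>.\<close>

locale sde_coefficients = jump_coefficient \<alpha> b "\<lambda>x. \<bar>\<sigma> x\<bar>" s'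
  for \<alpha> b :: real and \<sigma> s' :: "real \<Rightarrow> real" +
  fixes \<beta> :: real and f g :: "real \<Rightarrow> real"
  assumes \<beta>: "- 1 < \<beta>" "\<beta> < 1"
    and f_cont: "continuous_on UNIV f" and g_cont: "continuous_on UNIV g"
    and b_eq: "\<And>x. b = sgn (\<sigma> x) * \<beta>"
    and nu_tilde_eq: "nu_tilde \<alpha> \<beta> \<sigma> = nu \<alpha> (- b)"
    and \<sigma>_deriv: "\<And>x. \<beta> * deriv \<sigma> x = b * s' x"
begin

abbreviation A where "A \<equiv> generator \<alpha> \<beta> f g \<sigma>"

lemma generator_eq:
  assumes \<phi>: "\<phi> \<in> C2c"
  shows "A \<phi> x = f x * deriv \<phi> x + 1/2 * (g x)\<^sup>2 * deriv (deriv \<phi>) x + nonlocal \<phi> x"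
proof -
  note C2c_measurable(1)[OF \<phi>, measurable]
  have \<sigma>0: "\<sigma> x \<noteq> 0" using s_pos[of x] by simp
  let ?E = "\<lambda>z. compensated_increment \<phi> (\<lambda>x. \<bar>\<sigma> x\<bar>) x z"
  \<comment> \<open>Scaling by \<sigma> turns the cut-off at 1 into the cut-off at its absolute
    value.\<close>
  have E: "\<phi> (x + \<sigma> x * y) - \<phi> x - \<sigma> x * y * deriv \<phi> x * indicator {y. \<bar>y\<bar> < 1} y = ?E (\<sigma> x * y)" for y
    using \<sigma>0 mult_less_cancel_left_pos[of "\<bar>\<sigma> x\<bar>" "\<bar>y\<bar>" 1]
    by (auto simp: compensated_increment_def indicator_def abs_mult)
  have "(LINT y:-{0}|nu \<alpha> \<beta>.
          \<phi> (x + \<sigma> x * y) - \<phi> x - \<sigma> x * y * deriv \<phi> x * indicator {y. \<bar>y\<bar> < 1} y)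
      = (LINT y|lborel. ?E (\<sigma> x * y) * stable_kernel \<alpha> \<beta> y)"
    unfolding E[symmetric] by (rule LINT_nu[OF \<alpha> \<beta>]) measurable
  also have "\<dots> = \<bar>\<sigma> x\<bar> powr \<alpha> * (LINT z|lborel. ?E z * k z)"
    using stable_kernel_integral_scale[OF \<sigma>0, of ?E \<alpha> \<beta>] b_eq[of x] by simp
  finally show ?thesis by (simp add: generator_def nonlocal_def)
qed

lemma local_part_L2:
  assumes "\<phi> \<in> C2c"
  shows "(\<lambda>x. f x * deriv \<phi> x) \<in> L2" "(\<lambda>x. 1/2 * (g x)\<^sup>2 * deriv (deriv \<phi>) x) \<in> L2"
proof -
  from assms obtain R where
    c: "continuous_on UNIV (deriv \<phi>)" "continuous_on UNIV (deriv (deriv \<phi>))" and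
    z: "\<And>x. R \<le> \<bar>x\<bar> \<Longrightarrow> deriv \<phi> x = 0" "\<And>x. R \<le> \<bar>x\<bar> \<Longrightarrow> deriv (deriv \<phi>) x = 0"
    by (rule C2cE) blast
  show "(\<lambda>x. f x * deriv \<phi> x) \<in> L2" "(\<lambda>x. 1/2 * (g x)\<^sup>2 * deriv (deriv \<phi>) x) \<in> L2"
    by (intro continuous_compact_support_L2[where R = R] continuous_intros f_cont g_cont c; simp add: z)+
qed

lemma generator_L2:
  assumes "\<phi> \<in> C2c"
  shows "A \<phi> \<in> L2"
proof -
  have "A \<phi> = (\<lambda>x. f x * deriv \<phi> x + 1/2 * (g x)\<^sup>2 * deriv (deriv \<phi>) x + nonlocal \<phi> x)"
    by (rule ext) (rule generator_eq[OF assms])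
  then show ?thesis
    using L2_add[OF L2_add[OF local_part_L2[OF assms]] nonlocal_L2[OF assms]] by simp
qed

context
  fixes v :: "real \<Rightarrow> real"
  assumes reg: "fp_regular \<alpha> \<beta> f g \<sigma> v"
begin

abbreviation u where "u \<equiv> \<lambda>x. \<bar>\<sigma> x\<bar> powr \<alpha> * v x"

text \<open>The kernel carries \<open>-b\<close> because the adjoint reverses the jumps.\<close>

definition jump_part :: "real \<Rightarrow> real" where
  "jump_part x = (LINT z|lborel. compensated_increment u (\<lambda>x. \<bar>\<sigma> x\<bar>) x z * stable_kernel \<alpha> (- b) z)"

lemma regD:
  "v \<in> L2" "locally_ac (\<lambda>x. f x * v x)" "locally_ac (\<lambda>x. (g x)\<^sup>2 * v x)"
  "locally_ac (deriv (\<lambda>x. (g x)\<^sup>2 * v x))" "locally_ac u"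
  "set_integrable (lborel \<Otimes>\<^sub>M nu \<alpha> (- b)) ({a..c} \<times> (-{0}))
     (\<lambda>(x, z). compensated_increment u (\<lambda>x. \<bar>\<sigma> x\<bar>) x z)"
  using reg unfolding fp_regular_def nu_tilde_eq Q_integrand_eq by auto

lemma pair_integrable:
  "integrable (lborel \<Otimes>\<^sub>M lborel) (\<lambda>(x, z). indicator {a..c} x *
     compensated_increment u (\<lambda>x. \<bar>\<sigma> x\<bar>) x z * stable_kernel \<alpha> (- b) z)"
  using set_integrable_lborel_nuD(1)[OF \<alpha> _ _ regD(6), of a c] b by simp

lemma pair_measurable:
  "(\<lambda>(x, z). indicator {a..c} x * indicator (-{0}) z * compensated_increment u (\<lambda>x. \<bar>\<sigma> x\<bar>) x z)
     \<in> borel_measurable (borel \<Otimes>\<^sub>M borel)"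
  using set_integrable_lborel_nuD(2)[OF \<alpha> _ _ regD(6), of a c] b by simp

lemma v_cont: "continuous_on UNIV v"
proof -
  have s0: "\<bar>\<sigma> x\<bar> \<noteq> 0" for x using s_pos[of x] by simp
  have "continuous_on UNIV (\<lambda>x. u x / \<bar>\<sigma> x\<bar> powr \<alpha>)"
    by (intro continuous_intros locally_ac_continuous[OF regD(5)] s_cont) (use s0 in auto)
  then show ?thesis using s0 by simp
qed

lemma B_star_eq:
  "B_star \<alpha> \<beta> f g \<sigma> v x = - deriv (\<lambda>y. f y * v y) x + 1/2 * deriv (deriv (\<lambda>y. (g y)\<^sup>2 * v y)) x
     + (jump_part x + b * C_stable \<alpha> * (v x * s' x))"
proof -
  have [measurable]: "u \<in> borel_measurable borel"
    using locally_ac_continuous[OF regD(5)] by (rule borel_measurable_continuous_onI)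
  have "(LINT z:-{0}|nu \<alpha> (- b). compensated_increment u (\<lambda>x. \<bar>\<sigma> x\<bar>) x z) = jump_part x"
    unfolding jump_part_def
  proof (rule LINT_nu[OF \<alpha>])
    show "compensated_increment u (\<lambda>x. \<bar>\<sigma> x\<bar>) x \<in> borel_measurable borel"
      unfolding compensated_increment_def indicator_def mem_Collect_eq by measurable
  qed (use b in auto)
  moreover have "\<beta> * C_stable \<alpha> * v x * deriv \<sigma> x = b * C_stable \<alpha> * (v x * s' x)"
    using \<sigma>_deriv[of x] by algebra
  ultimately show ?thesis
    by (simp add: B_star_def Q_star_def nu_tilde_eq Q_integrand_eq)
qed

lemma locally_integrable_parts:
  "set_integrable lebesgue {a..c} (deriv (\<lambda>y. f y * v y))"
  "set_integrable lebesgue {a..c} (deriv (deriv (\<lambda>y. (g y)\<^sup>2 * v y)))"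
  "set_integrable lebesgue {a..c} jump_part"
  "set_integrable lebesgue {a..c} (\<lambda>x. v x * s' x)"
proof -
  show "set_integrable lebesgue {a..c} (deriv (\<lambda>y. f y * v y))"
    "set_integrable lebesgue {a..c} (deriv (deriv (\<lambda>y. (g y)\<^sup>2 * v y)))"
    using regD(2,4) by (cases "a \<le> c"; auto simp: locally_ac_def)+
  have "integrable lborel (\<lambda>x. indicator {a..c} x * jump_part x)"
    using lborel_pair.integrable_fst'[OF pair_integrable[of a c]]
    by (simp add: jump_part_def mult.assoc)
  then show "set_integrable lebesgue {a..c} jump_part"
    by (simp add: set_integrable_def integrable_completion borel_measurable_integrable)
  show "set_integrable lebesgue {a..c} (\<lambda>x. v x * s' x)"
    by (intro absolutely_integrable_continuous_real continuous_on_subset[OF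
        continuous_on_mult[OF v_cont s'_cont]]) auto
qed

lemma B_star_locally_integrable: "set_integrable lebesgue {a..c} (B_star \<alpha> \<beta> f g \<sigma> v)"
proof -
  have "set_integrable lebesgue {a..c} (\<lambda>x. - 1 * deriv (\<lambda>y. f y * v y) x
     + 1/2 * deriv (deriv (\<lambda>y. (g y)\<^sup>2 * v y)) x + (jump_part x + b * C_stable \<alpha> * (v x * s' x)))"
    by (intro set_integral_add(1) set_integrable_mult_right locally_integrable_parts)
  then show ?thesis by (simp add: B_star_eq[abs_def])
qed

lemma generator_duality:
  assumes \<phi>: "\<phi> \<in> C2c"
  shows "(LINT x|lebesgue. A \<phi> x * v x) = (LINT x|lebesgue. \<phi> x * B_star \<alpha> \<beta> f g \<sigma> v x)"
proof -
  from \<phi> obtain R where R: "R > 0" and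
    D1: "\<And>x. (\<phi> has_real_derivative deriv \<phi> x) (at x)" and
    D2: "\<And>x. (deriv \<phi> has_real_derivative deriv (deriv \<phi>) x) (at x)" and
    c1: "continuous_on UNIV (deriv \<phi>)" and c2: "continuous_on UNIV (deriv (deriv \<phi>))" and
    z: "\<And>x. R \<le> \<bar>x\<bar> \<Longrightarrow> \<phi> x = 0" "\<And>x. R \<le> \<bar>x\<bar> \<Longrightarrow> deriv \<phi> x = 0"
      "\<And>x. R \<le> \<bar>x\<bar> \<Longrightarrow> deriv (deriv \<phi>) x = 0"
    by (rule C2cE) blast
  have [measurable]: "v \<in> borel_measurable borel" using v_cont by (rule borel_measurable_continuous_onI)
  have [measurable]: "s' \<in> borel_measurable borel" using s'_cont by (rule borel_measurable_continuous_onI)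
  note C2c_measurable(1)[OF \<phi>, measurable] nonlocal_measurable[OF \<phi>, measurable]
  note i = locally_integrable_parts[THEN C2c_mult_integrable[OF \<phi>]]
  let ?F = "\<lambda>y. f y * v y" and ?G = "\<lambda>y. (g y)\<^sup>2 * v y"
  have F: "(LINT x|lebesgue. \<phi> x * deriv ?F x) = - (LINT x|lebesgue. deriv \<phi> x * ?F x)"
    by (rule locally_ac_by_parts_compact_support(2)[OF regD(2) R D1 c1]) (use z in auto)
  \<comment> \<open>The second-order term is integrated by parts twice, once for
    \<open>deriv ?G\<close> and once for \<open>?G\<close>.\<close>
  have G1: "(LINT x|lebesgue. \<phi> x * deriv (deriv ?G) x) = - (LINT x|lebesgue. deriv \<phi> x * deriv ?G x)"
    by (rule locally_ac_by_parts_compact_support(2)[OF regD(4) R D1 c1]) (use z in auto)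
  have G2: "(LINT x|lebesgue. deriv \<phi> x * deriv ?G x) = - (LINT x|lebesgue. deriv (deriv \<phi>) x * ?G x)"
    by (rule locally_ac_by_parts_compact_support(2)[OF regD(3) R D2 c2]) (use z in auto)
  have J: "(LINT x|lebesgue. nonlocal \<phi> x * v x) = (LINT x|lebesgue. \<phi> x * jump_part x)
      + b * C_stable \<alpha> * (LINT x|lebesgue. \<phi> x * (v x * s' x))"
  proof -
    \<comment> \<open>Borel measurability is what allows the integrals over \<open>lebesgue\<close>
      to be replaced by integrals over \<open>lborel\<close>.\<close>
    have jm: "jump_part \<in> borel_measurable borel"
    proof -
      have cu: "continuous_on UNIV u" by (rule locally_ac_continuous[OF regD(5)])
      have [measurable]: "u \<in> borel_measurable borel" using cu by (rule borel_measurable_continuous_onI)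
      have [measurable]: "deriv u \<in> borel_measurable borel"
        by (rule deriv_measurable_of_increment[OF cu pair_measurable])
      have [measurable]: "(\<lambda>(x, z). compensated_increment u (\<lambda>x. \<bar>\<sigma> x\<bar>) x z)
          \<in> borel_measurable (borel \<Otimes>\<^sub>M borel)"
        by (rule compensated_increment_measurable) measurable
      have "(\<lambda>x. LINT z|lborel. (\<lambda>(x, z). compensated_increment u (\<lambda>x. \<bar>\<sigma> x\<bar>) x z
          * stable_kernel \<alpha> (- b) z) (x, z)) \<in> borel_measurable borel"
        by (rule lborel.borel_measurable_lebesgue_integral) measurable
      then show ?thesis unfolding jump_part_def[abs_def] by simp
    qed
    note jm[measurable]
    show ?thesis
      using nonlocal_adjoint[OF \<phi> regD(1) regD(5) pair_measurable pair_integrable]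
      by (simp add: integral_completion jump_part_def[symmetric])
  qed
  have i1: "integrable lebesgue (\<lambda>x. deriv \<phi> x * ?F x)" "integrable lebesgue (\<lambda>x. deriv (deriv \<phi>) x * ?G x)"
    and i2: "integrable lebesgue (\<lambda>x. nonlocal \<phi> x * v x)"
  proof -
    show "integrable lebesgue (\<lambda>x. nonlocal \<phi> x * v x)"
      by (rule L2_integrable_mult[OF nonlocal_L2[OF \<phi>] regD(1)])
    have *: "integrable lebesgue h" if "continuous_on UNIV h" "\<And>x. R \<le> \<bar>x\<bar> \<Longrightarrow> h x = 0" for h :: "real \<Rightarrow> real"
      using continuous_compact_support_integrable[OF that]
      by (simp add: integrable_completion borel_measurable_integrable)
    show "integrable lebesgue (\<lambda>x. deriv \<phi> x * ?F x)" "integrable lebesgue (\<lambda>x. deriv (deriv \<phi>) x * ?G x)"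
      by (rule *; use z in \<open>auto intro!: continuous_intros c1 c2 f_cont g_cont v_cont\<close>)+
  qed
  have "(LINT x|lebesgue. A \<phi> x * v x)
      = (LINT x|lebesgue. deriv \<phi> x * ?F x + 1/2 * (deriv (deriv \<phi>) x * ?G x) + nonlocal \<phi> x * v x)"
    by (simp add: generator_eq[OF \<phi>] algebra_simps)
  also have "\<dots> = (LINT x|lebesgue. deriv \<phi> x * ?F x) + 1/2 * (LINT x|lebesgue. deriv (deriv \<phi>) x * ?G x)
      + (LINT x|lebesgue. nonlocal \<phi> x * v x)"
    using i1 i2 by simp
  also have "\<dots> = - (LINT x|lebesgue. \<phi> x * deriv ?F x) + 1/2 * (LINT x|lebesgue. \<phi> x * deriv (deriv ?G) x)
      + ((LINT x|lebesgue. \<phi> x * jump_part x) + b * C_stable \<alpha> * (LINT x|lebesgue. \<phi> x * (v x * s' x)))"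
    using F G1 G2 J by simp
  also have "\<dots> = (LINT x|lebesgue. - (\<phi> x * deriv ?F x) + 1/2 * (\<phi> x * deriv (deriv ?G) x)
      + (\<phi> x * jump_part x + b * C_stable \<alpha> * (\<phi> x * (v x * s' x))))"
    using i by simp
  also have "\<dots> = (LINT x|lebesgue. \<phi> x * B_star \<alpha> \<beta> f g \<sigma> v x)"
    by (simp add: B_star_eq algebra_simps)
  finally show ?thesis .
qed

text \<open>If \<open>w\<close> represents the adjoint, then by duality \<open>w\<close> minus the
  explicit expression annihilates every test function. The comparison uses local integrability,
  since square integrability of the explicit expression is not known in advance but follows from
  that of \<open>w\<close>.\<close>

lemma is_adjoint_iff:
  "is_adjoint A C2c v w \<longleftrightarrow> w \<in> L2 \<and> (AE x in lebesgue. w x = B_star \<alpha> \<beta> f g \<sigma> v x)"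
proof
  assume adj: "is_adjoint A C2c v w"
  then have w: "w \<in> L2" by (simp add: is_adjoint_def)
  have "AE x in lebesgue. w x - B_star \<alpha> \<beta> f g \<sigma> v x = 0"
  proof (rule fundamental_lemma_calculus_of_variations)
    show "set_integrable lebesgue {a..c} (\<lambda>x. w x - B_star \<alpha> \<beta> f g \<sigma> v x)" for a c
      by (intro set_integral_diff(1) L2_set_integrable w B_star_locally_integrable)
    fix \<phi> assume \<phi>: "\<phi> \<in> C2c"
    have "(LINT x|lebesgue. \<phi> x * (w x - B_star \<alpha> \<beta> f g \<sigma> v x))
        = (LINT x|lebesgue. \<phi> x * w x) - (LINT x|lebesgue. \<phi> x * B_star \<alpha> \<beta> f g \<sigma> v x)"
      unfolding right_diff_distrib
      by (intro Bochner_Integration.integral_diff C2c_mult_integrable \<phi> L2_set_integrable w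
          B_star_locally_integrable)
    also have "\<dots> = 0"
      using adj \<phi> generator_duality[OF \<phi>] by (simp add: is_adjoint_def)
    finally show "(LINT x|lebesgue. \<phi> x * (w x - B_star \<alpha> \<beta> f g \<sigma> v x)) = 0" .
  qed
  with w show "w \<in> L2 \<and> (AE x in lebesgue. w x = B_star \<alpha> \<beta> f g \<sigma> v x)" by simp
next
  assume w: "w \<in> L2 \<and> (AE x in lebesgue. w x = B_star \<alpha> \<beta> f g \<sigma> v x)"
  have "(LINT x|lebesgue. A \<phi> x * v x) = (LINT x|lebesgue. \<phi> x * w x)" if \<phi>: "\<phi> \<in> C2c" for \<phi>
    unfolding generator_duality[OF \<phi>]
  proof (rule integral_cong_AE)
    show "(\<lambda>x. \<phi> x * B_star \<alpha> \<beta> f g \<sigma> v x) \<in> borel_measurable lebesgue"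
      "(\<lambda>x. \<phi> x * w x) \<in> borel_measurable lebesgue"
      using w by (auto intro!: borel_measurable_integrable C2c_mult_integrable \<phi> L2_set_integrable
          B_star_locally_integrable)
    show "AE x in lebesgue. \<phi> x * B_star \<alpha> \<beta> f g \<sigma> v x = \<phi> x * w x"
      using conjunct2[OF w] by eventually_elim simp
  qed
  with w regD(1) show "is_adjoint A C2c v w" by (simp add: is_adjoint_def)
qed

end

text \<open>The adjoint image is unique up to null sets, so the existential over \<open>w\<close>
  collapses to the explicit operator.\<close>

lemma fokker_planck_iff_explicit:
  assumes reg: "\<And>t. t > 0 \<Longrightarrow> fp_regular \<alpha> \<beta> f g \<sigma> (p t)"
  shows "fokker_planck \<alpha> \<beta> f g \<sigma> p \<longleftrightarrow> explicit_fokker_planck \<alpha> \<beta> f g \<sigma> p"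
proof -
  have "(\<exists>w. is_adjoint A C2c (p t) w \<and> (AE x in lebesgue. ((\<lambda>s. p s x) has_real_derivative w x) (at t)))
    \<longleftrightarrow> B_star \<alpha> \<beta> f g \<sigma> (p t) \<in> L2
      \<and> (AE x in lebesgue. ((\<lambda>s. p s x) has_real_derivative B_star \<alpha> \<beta> f g \<sigma> (p t) x) (at t))"
    if t: "t > 0" for t
    unfolding is_adjoint_iff[OF reg[OF t]]
  proof
    assume "\<exists>w. (w \<in> L2 \<and> (AE x in lebesgue. w x = B_star \<alpha> \<beta> f g \<sigma> (p t) x))
      \<and> (AE x in lebesgue. ((\<lambda>s. p s x) has_real_derivative w x) (at t))"
    then obtain w where "w \<in> L2" and eq: "AE x in lebesgue. w x = B_star \<alpha> \<beta> f g \<sigma> (p t) x"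
      and d: "AE x in lebesgue. ((\<lambda>s. p s x) has_real_derivative w x) (at t)" by blast
    from d eq have "AE x in lebesgue. ((\<lambda>s. p s x) has_real_derivative B_star \<alpha> \<beta> f g \<sigma> (p t) x) (at t)"
      by eventually_elim simp
    with L2_AE_cong[OF \<open>w \<in> L2\<close> eq] show "B_star \<alpha> \<beta> f g \<sigma> (p t) \<in> L2
      \<and> (AE x in lebesgue. ((\<lambda>s. p s x) has_real_derivative B_star \<alpha> \<beta> f g \<sigma> (p t) x) (at t))"
      by blast
  next
    assume "B_star \<alpha> \<beta> f g \<sigma> (p t) \<in> L2
      \<and> (AE x in lebesgue. ((\<lambda>s. p s x) has_real_derivative B_star \<alpha> \<beta> f g \<sigma> (p t) x) (at t))"
    then show "\<exists>w. (w \<in> L2 \<and> (AE x in lebesgue. w x = B_star \<alpha> \<beta> f g \<sigma> (p t) x))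
      \<and> (AE x in lebesgue. ((\<lambda>s. p s x) has_real_derivative w x) (at t))"
      by (intro exI[of _ "B_star \<alpha> \<beta> f g \<sigma> (p t)"]) simp
  qed
  then show ?thesis by (simp add: fokker_planck_def explicit_fokker_planck_def)
qed

end

section \<open>Consequences of the hypotheses on the coefficients\<close>

text \<open>The jump integrals in (H1) and (H2) are this moment times a square; its positivity lets
  the bound on the integral be divided down to a Lipschitz bound for \<sigma>.\<close>

lemma nu_sym_second_moment:
  assumes "0 < \<alpha>" "\<alpha> < 2"
  obtains \<kappa> where "\<kappa> > 0"
    and "\<And>c. (LINT y:{y. \<bar>y\<bar> < 1}|nu_sym \<alpha>. \<bar>c * y\<bar>\<^sup>2) = c\<^sup>2 * \<kappa>"
proof -
  define w where "w y = c1 \<alpha> / \<bar>y\<bar> powr (1 + \<alpha>) * (indicator {y. \<bar>y\<bar> < 1} y * y\<^sup>2)" for y :: real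
  have c1: "c1 \<alpha> > 0" using assms by (simp add: c1_def Gamma_real_pos)
  have [measurable]: "w \<in> borel_measurable borel"
    unfolding w_def indicator_def mem_Collect_eq by measurable
  have "integrable lborel w"
  proof (rule Bochner_Integration.integrable_bound)
    show "integrable lborel (\<lambda>y::real. c1 \<alpha> * (min 1 (y\<^sup>2) / \<bar>y\<bar> powr (1 + \<alpha>)))"
      by (intro integrable_mult_right integrable_min_1_square_powr assms)
    have "norm (w y) \<le> norm (c1 \<alpha> * (min 1 (y\<^sup>2) / \<bar>y\<bar> powr (1 + \<alpha>)))" for y
    proof (cases "\<bar>y\<bar> < 1")
      case True
      then have "y\<^sup>2 \<le> 1" by (simp add: abs_square_le_1)
      with True show ?thesis by (simp add: w_def abs_mult)
    qed (simp add: w_def)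
    then show "AE y in lborel. norm (w y) \<le> norm (c1 \<alpha> * (min 1 (y\<^sup>2) / \<bar>y\<bar> powr (1 + \<alpha>)))" by simp
  qed measurable
  moreover have w0: "w y \<ge> 0" for y using c1 by (simp add: w_def)
  ultimately have eq0: "(LINT y|lborel. w y) = 0 \<longleftrightarrow> (AE y in lborel. w y = 0)"
    by (intro integral_nonneg_eq_0_iff_AE) auto
  \<comment> \<open>The integrand is positive on \<open>{0<..<1}\<close>, which is not a null
    set.\<close>
  have "\<not> (AE y in lborel. w y = 0)"
  proof
    assume "AE y in lborel. w y = 0"
    then have "AE y in lborel. y \<notin> {0<..<1::real}"
      by eventually_elim (use c1 in \<open>auto simp: w_def\<close>)
    then have "{0<..<1::real} \<in> null_sets lborel"
      by (subst AE_iff_null_sets) auto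
    then show False by (auto simp: null_sets_def)
  qed
  moreover have "(LINT y|lborel. w y) \<ge> 0" using w0 by simp
  ultimately have pos: "(LINT y|lborel. w y) > 0" using eq0 by simp
  have "(LINT y:{y. \<bar>y\<bar> < 1}|nu_sym \<alpha>. \<bar>c * y\<bar>\<^sup>2) = c\<^sup>2 * (LINT y|lborel. w y)" for c
  proof -
    have "(LINT y:{y. \<bar>y\<bar> < 1}|nu_sym \<alpha>. \<bar>c * y\<bar>\<^sup>2)
        = (LINT y|lborel. (c1 \<alpha> / \<bar>y\<bar> powr (1 + \<alpha>)) *\<^sub>R (indicator {y. \<bar>y\<bar> < 1} y *\<^sub>R \<bar>c * y\<bar>\<^sup>2))"
      unfolding set_lebesgue_integral_def nu_sym_def
    proof (rule integral_density)
      show "(\<lambda>y. indicator {y. \<bar>y\<bar> < 1} y *\<^sub>R \<bar>c * y\<bar>\<^sup>2) \<in> borel_measurable lborel"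
        unfolding indicator_def mem_Collect_eq by measurable
    qed (use c1 in auto)
    also have "\<dots> = (LINT y|lborel. c\<^sup>2 * w y)"
      by (intro Bochner_Integration.integral_cong) (auto simp: w_def power_mult_distrib)
    finally show ?thesis by simp
  qed
  with pos show thesis by (rule that)
qed

lemma square_lipschitz_imp_continuous:
  fixes h :: "real \<Rightarrow> real"
  assumes "\<And>x y. (h x - h y)\<^sup>2 \<le> C * (x - y)\<^sup>2"
  shows "\<bar>h x - h y\<bar> \<le> sqrt C * \<bar>x - y\<bar>" and "continuous_on UNIV h"
proof -
  show *: "\<bar>h x - h y\<bar> \<le> sqrt C * \<bar>x - y\<bar>" for x y
    using real_sqrt_le_mono[OF assms[of x y]] by (simp add: real_sqrt_mult)
  have "C \<ge> 0" using order_trans[OF zero_le_power2 assms[of 1 0]] by simp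
  then have "(sqrt C)-lipschitz_on UNIV h"
    using * by (intro lipschitz_onI) (auto simp: dist_real_def)
  then show "continuous_on UNIV h" by (rule lipschitz_on_continuous_on)
qed

text \<open>\<open>s\<close> is the power \<open>1 / \<alpha>\<close> of a positive C1 function, and
  powers are smooth away from 0.\<close>

lemma C1_root:
  fixes s :: "real \<Rightarrow> real"
  assumes "0 < \<alpha>" and pos: "\<And>x. 0 < s x" and C1: "(\<lambda>x. s x powr \<alpha>) C1_differentiable_on UNIV"
  obtains s' where "\<And>x. (s has_real_derivative s' x) (at x)" "continuous_on UNIV s'"
proof -
  obtain D where D: "\<And>x. ((\<lambda>x. s x powr \<alpha>) has_real_derivative D x) (at x)" and cD: "continuous_on UNIV D"
    using C1 by (auto simp: C1_differentiable_on_def has_real_derivative_iff_has_vector_derivative)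
  have P: "0 < s x powr \<alpha>" for x using pos[of x] by simp
  have eq: "s = (\<lambda>x. (s x powr \<alpha>) powr (1 / \<alpha>))"
    using assms(1) pos by (simp add: powr_powr fun_eq_iff less_imp_le)
  have cs: "continuous_on UNIV (\<lambda>x. s x powr \<alpha>)"
    using D by (meson DERIV_isCont continuous_at_imp_continuous_on)
  let ?s' = "\<lambda>x. 1 / \<alpha> * (s x powr \<alpha>) powr (1 / \<alpha> - 1) * D x"
  show thesis
  proof (rule that[of ?s'])
    show "(s has_real_derivative ?s' x) (at x)" for x
      by (subst eq) (use DERIV_chain2[OF has_real_derivative_powr[OF P] D[of x], of "1 / \<alpha>"] in \<open>simp add: o_def\<close>)
    show "continuous_on UNIV ?s'"
      by (intro continuous_intros cs cD) (use P in \<open>auto simp: less_imp_neq[symmetric]\<close>)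
  qed
qed

text \<open>The first conjunct makes the generator an operator from \<open>C2c\<close> into
  \<open>L2\<close>, so that its Hilbert space adjoint makes sense. The second identifies the graph
  of that adjoint on regular functions, the third carries this over to the evolution equation, and
  the fourth is the initial condition.\<close>

theorem theorem2:
  fixes \<alpha> \<beta> x0 :: real
    and f g \<sigma> :: "real \<Rightarrow> real"
    and M :: "'w measure" and F :: "real \<Rightarrow> 'w measure"
    and B L X :: "real \<Rightarrow> 'w \<Rightarrow> real"
  assumes \<alpha>: "0 < \<alpha>" "\<alpha> < 2"
    and \<beta>: "- 1 < \<beta>" "\<beta> < 1"
    and H1: "\<exists>\<gamma>>0. \<forall>x1 x2. \<bar>f x1 - f x2\<bar>\<^sup>2 + \<bar>g x1 - g x2\<bar>\<^sup>2
               + (LINT y:{y. \<bar>y\<bar> < 1}|nu_sym \<alpha>. \<bar>\<sigma> x1 * y - \<sigma> x2 * y\<bar>\<^sup>2) \<le> \<gamma> * \<bar>x1 - x2\<bar>\<^sup>2"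
    and H2: "\<exists>K>0. \<forall>x. 2 * x * f x + \<bar>g x\<bar>\<^sup>2
               + (LINT y:{y. \<bar>y\<bar> < 1}|nu_sym \<alpha>. \<bar>\<sigma> x * y\<bar>\<^sup>2) \<le> K * (1 + x\<^sup>2)"
    and H3: "(\<lambda>x. \<bar>\<sigma> x\<bar> powr \<alpha>) C1_differentiable_on UNIV" "\<forall>x. \<sigma> x \<noteq> 0"
    and H4: "strict_mono \<sigma> \<or> strict_antimono_on UNIV \<sigma>"
    and cases_of_nu_tilde: "((\<forall>x. 0 < \<sigma> x) \<and> strict_mono \<sigma>)
               \<or> ((\<forall>x. \<sigma> x < 0) \<and> strict_antimono_on UNIV \<sigma>)"
  shows "(\<forall>\<phi>\<in>C2c. generator \<alpha> \<beta> f g \<sigma> \<phi> \<in> L2)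
       \<and> (\<forall>v w. fp_regular \<alpha> \<beta> f g \<sigma> v \<longrightarrow>
            (is_adjoint (generator \<alpha> \<beta> f g \<sigma>) C2c v w
               \<longleftrightarrow> w \<in> L2 \<and> (AE x in lebesgue. w x = B_star \<alpha> \<beta> f g \<sigma> v x)))
       \<and> (\<forall>p. (\<forall>t>0. fp_regular \<alpha> \<beta> f g \<sigma> (p t)) \<longrightarrow>
            (fokker_planck \<alpha> \<beta> f g \<sigma> p \<longleftrightarrow> explicit_fokker_planck \<alpha> \<beta> f g \<sigma> p))
       \<and> (\<forall>p. sde_solution M F B L \<alpha> \<beta> f g \<sigma> x0 X \<and> has_densities M X p
            \<longrightarrow> dirac_initial p x0)"
proof -
  obtain \<gamma> where \<gamma>: "\<gamma> > 0" "\<And>x1 x2. \<bar>f x1 - f x2\<bar>\<^sup>2 + \<bar>g x1 - g x2\<bar>\<^sup>2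
      + (LINT y:{y. \<bar>y\<bar> < 1}|nu_sym \<alpha>. \<bar>\<sigma> x1 * y - \<sigma> x2 * y\<bar>\<^sup>2) \<le> \<gamma> * \<bar>x1 - x2\<bar>\<^sup>2"
    using H1 by blast
  obtain \<kappa> where \<kappa>: "\<kappa> > 0" "\<And>c. (LINT y:{y. \<bar>y\<bar> < 1}|nu_sym \<alpha>. \<bar>c * y\<bar>\<^sup>2) = c\<^sup>2 * \<kappa>"
    using nu_sym_second_moment[OF \<alpha>] by blast
  \<comment> \<open>With the second moment \<kappa> the jump term of (H1) becomes a multiple of
    \<open>(\<sigma> x1 - \<sigma> x2)\<^sup>2\<close>; all three summands are nonnegative, so each
    obeys the bound by itself.\<close>
  have lip: "(f x1 - f x2)\<^sup>2 + (g x1 - g x2)\<^sup>2 + (\<sigma> x1 - \<sigma> x2)\<^sup>2 * \<kappa> \<le> \<gamma> * (x1 - x2)\<^sup>2" for x1 x2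
    using \<gamma>(2)[of x1 x2] \<kappa>(2)[of "\<sigma> x1 - \<sigma> x2"] by (simp add: left_diff_distrib)
  have \<sigma>\<kappa>: "0 \<le> (\<sigma> x1 - \<sigma> x2)\<^sup>2 * \<kappa>" for x1 x2 using \<kappa>(1) by simp
  have "(f x1 - f x2)\<^sup>2 \<le> \<gamma> * (x1 - x2)\<^sup>2" "(g x1 - g x2)\<^sup>2 \<le> \<gamma> * (x1 - x2)\<^sup>2" for x1 x2
    using lip[of x1 x2] \<sigma>\<kappa>[of x1 x2] zero_le_power2[of "f x1 - f x2"] zero_le_power2[of "g x1 - g x2"]
    by linarith+
  then have cont: "continuous_on UNIV f" "continuous_on UNIV g"
    using square_lipschitz_imp_continuous(2)[of f \<gamma>] square_lipschitz_imp_continuous(2)[of g \<gamma>] by blast+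
  have "(\<sigma> x1 - \<sigma> x2)\<^sup>2 \<le> \<gamma> / \<kappa> * (x1 - x2)\<^sup>2" for x1 x2
  proof -
    have "(\<sigma> x1 - \<sigma> x2)\<^sup>2 * \<kappa> \<le> \<gamma> * (x1 - x2)\<^sup>2"
      using lip[of x1 x2] zero_le_power2[of "f x1 - f x2"] zero_le_power2[of "g x1 - g x2"] by linarith
    then show ?thesis using \<kappa>(1) by (simp add: field_simps)
  qed
  then have \<sigma>_lip: "\<bar>\<sigma> x - \<sigma> y\<bar> \<le> sqrt (\<gamma> / \<kappa>) * \<bar>x - y\<bar>" for x y
    by (rule square_lipschitz_imp_continuous(1))
  have growth: "\<bar>\<sigma> x\<bar> \<le> (\<bar>\<sigma> 0\<bar> + sqrt (\<gamma> / \<kappa>)) * (1 + \<bar>x\<bar>)" for x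
  proof -
    have "\<bar>\<sigma> x\<bar> \<le> \<bar>\<sigma> 0\<bar> + sqrt (\<gamma> / \<kappa>) * \<bar>x\<bar>" using \<sigma>_lip[of x 0] by simp
    moreover have "0 \<le> \<bar>\<sigma> 0\<bar> * \<bar>x\<bar>" "0 \<le> sqrt (\<gamma> / \<kappa>)" using \<gamma>(1) \<kappa>(1) by auto
    ultimately show ?thesis unfolding distrib_left distrib_right mult_1_right by linarith
  qed
  have s_pos: "0 < \<bar>\<sigma> x\<bar>" for x using H3(2) by simp
  obtain s' where s': "\<And>x. ((\<lambda>x. \<bar>\<sigma> x\<bar>) has_real_derivative s' x) (at x)" "continuous_on UNIV s'"
    using C1_root[OF \<alpha>(1) s_pos H3(1)] by blast
  \<comment> \<open>The constant sign of \<sigma>. The locale is instantiated with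
    \<open>b = e * \<beta>\<close>, which gives \<open>nu \<alpha> (-\<beta>)\<close> in the
    positive case and \<open>nu \<alpha> \<beta>\<close> in the negative one.\<close>
  define e where "e = sgn (\<sigma> 0)"
  have e: "sgn (\<sigma> x) = e" "\<bar>e\<bar> = 1" for x
    using cases_of_nu_tilde H3(2) by (auto simp: e_def)
  have b: "- 1 < e * \<beta>" "e * \<beta> < 1"
    using \<beta> e(2) by (auto simp: abs_if split: if_splits)
  have mono: "strict_mono (\<lambda>x. \<bar>\<sigma> x\<bar>)"
    using cases_of_nu_tilde
  proof (elim disjE conjE)
    assume "\<forall>x. 0 < \<sigma> x" "strict_mono \<sigma>"
    then show ?thesis by (simp add: less_imp_le abs_of_pos)
  next
    assume "\<forall>x. \<sigma> x < 0" "strict_antimono_on UNIV \<sigma>"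
    then show ?thesis by (auto simp: strict_mono_def monotone_on_def abs_of_neg)
  qed
  have tilde: "nu_tilde \<alpha> \<beta> \<sigma> = nu \<alpha> (- (e * \<beta>))"
    using cases_of_nu_tilde
  proof (elim disjE conjE)
    assume "\<forall>x. 0 < \<sigma> x" "strict_mono \<sigma>"
    then show ?thesis by (simp add: nu_tilde_def e_def)
  next
    assume "\<forall>x. \<sigma> x < 0"
    then have "\<sigma> 0 < 0" by blast
    then have "\<not> 0 < \<sigma> 0" "sgn (\<sigma> 0) = - 1" by simp_all
    then show ?thesis unfolding nu_tilde_def e_def by auto
  qed
  have \<sigma>_deriv: "\<beta> * deriv \<sigma> x = e * \<beta> * s' x" for x
  proof -
    have "\<sigma> = (\<lambda>x. e * \<bar>\<sigma> x\<bar>)" using e(1) by (metis sgn_mult_abs)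
    then have "(\<sigma> has_real_derivative e * s' x) (at x)"
      using DERIV_cmult[OF s'(1)[of x], of e] by simp
    then have "deriv \<sigma> x = e * s' x" by (rule DERIV_imp_deriv)
    then show ?thesis by simp
  qed
  interpret sde_coefficients \<alpha> "e * \<beta>" \<sigma> s' \<beta> f g
    by unfold_locales (use \<alpha> \<beta> b s_pos mono s' growth cont e tilde \<sigma>_deriv in auto)
  show ?thesis
    using generator_L2 is_adjoint_iff fokker_planck_iff_explicit sde_solution_dirac_initial
    by blast
qed

end
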